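(* Let $K>0$ and $d\ge1$. There is a constant $K_d$, depending only on $K$ and $d$, such that the following holds for every $n\ge 1$. Let $X$ be a random vector in $\mathbb{R}^n$ such that for every seminorm $\varphi\colon\mathbb{R}^n\to\mathbb{R}_+$ we have $\mathbb{E}\varphi(X)<\infty$ and, for every $p\ge1$, $$\|\varphi(X)-\mathbb{E}\varphi(X)\|_p\le K\sqrt{p}\,\sup_{|\alpha|=1}\varphi(\alpha).$$ Let $X_1,\ldots,X_d$ be independent copies of $X$ and let $\psi\colon\bigotimes_{i=1}^d\mathbb{R}^n\to\mathbb{R}_+$ be a seminorm. Then for all $t\ge1$, $$\mathbb{P}\Big(\Big|\psi\Big(\bigotimes_{i=1}^dX_i\Big)-\mathbb{E}\psi\Big(\bigotimes_{i=1}^dX_i\Big)\Big|\ge K_d\sum_{I\subseteq\{1,\ldots,d\},\,I\neq\emptyset}t^{\#I/2}\,\mathbb{E}\sup_{|\alpha_k|\le1\colon k\in I}\psi\Big(\bigotimes_{i=1}^dX_{i,I,(\alpha_k)_{k\in I}}\Big)\Big)\le e^{-t},$$ where $X_{i,I,(\alpha_k)_{k\in I}}=X_i$ if $i\notin I$ and $X_{i,I,(\alpha_k)_{k\in I}}=\alpha_i$ if $i\in I$.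
   Context: $|\alpha|$ is the Euclidean norm of $\alpha\in\mathbb{R}^n$; $\|\xi\|_p=(\mathbb{E}|\xi|^p)^{1/p}$; $\#I$ is the cardinality of $I$. The supremum is over all families $(\alpha_k)_{k\in I}$ of vectors in $\mathbb{R}^n$ with $|\alpha_k|\le 1$ for every $k\in I$.
   Formalization: The seminorm ψ is assumed not identically zero, since for ψ≡0 the event is {0≥0} and has probability 1; formally K_d is chosen for a fixed type of sample points, and a single K_d for all follows by passing to the joint law of X_1,…,X_d. *)

theory Defs
  imports "HOL-Probability.Probability"
begin

text \<open>
  The dimension is quantified inside the statement, so \<open>\<real>\<close>-valued families over a finite
  index set \<open>J\<close> are modelled as extensional functions, the underlying space of
  \<^term>\<open>PiM J (\<lambda>_. borel)\<close>.  The same space serves for vectors (\<open>J = {1..n}\<close>) and for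
  tensors, identified with their coordinate arrays (\<open>J\<close> the set of multi-indices).
\<close>

definition coord_space :: "'i set \<Rightarrow> ('i \<Rightarrow> real) set" where
  "coord_space J = J \<rightarrow>\<^sub>E UNIV"

definition seminorm_on :: "'i set \<Rightarrow> (('i \<Rightarrow> real) \<Rightarrow> real) \<Rightarrow> bool" where
  "seminorm_on J \<phi> \<longleftrightarrow>
     (\<forall>x \<in> coord_space J. 0 \<le> \<phi> x) \<and>
     (\<forall>x \<in> coord_space J. \<forall>y \<in> coord_space J. \<phi> (\<lambda>j\<in>J. x j + y j) \<le> \<phi> x + \<phi> y) \<and>
     (\<forall>c. \<forall>x \<in> coord_space J. \<phi> (\<lambda>j\<in>J. c * x j) = \<bar>c\<bar> * \<phi> x)"

definition multi_indices :: "nat \<Rightarrow> nat \<Rightarrow> (nat \<Rightarrow> nat) set" where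
  "multi_indices d n = {1..d} \<rightarrow>\<^sub>E {1..n}"

definition tensor :: "nat \<Rightarrow> nat \<Rightarrow> (nat \<Rightarrow> nat \<Rightarrow> real) \<Rightarrow> (nat \<Rightarrow> nat) \<Rightarrow> real" where
  "tensor d n x = (\<lambda>j \<in> multi_indices d n. \<Prod>i = 1..d. x i (j i))"

definition unit_ball :: "nat \<Rightarrow> (nat \<Rightarrow> real) set" where
  "unit_ball n = {a \<in> coord_space {1..n}. L2_set a {1..n} \<le> 1}"

definition unit_sphere :: "nat \<Rightarrow> (nat \<Rightarrow> real) set" where
  "unit_sphere n = {a \<in> coord_space {1..n}. L2_set a {1..n} = 1}"

text \<open>The value is in \<^typ>\<open>ennreal\<close> so that an infinite moment is not collapsed to \<open>0\<close>.\<close>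

definition Lp_norm :: "'a measure \<Rightarrow> real \<Rightarrow> ('a \<Rightarrow> real) \<Rightarrow> ennreal" where
  "Lp_norm M p \<xi> =
     (let m = \<integral>\<^sup>+\<omega>. ennreal (\<bar>\<xi> \<omega>\<bar> powr p) \<partial>M
      in if m = \<infinity> then \<infinity> else ennreal (enn2real m powr (1 / p)))"

end

(*
The map (x_1, ..., x_d) |-> psi(x_1 (x) ... (x) x_d) is a seminorm in each slot separately, and this class of
functions is closed under taking the expectation over one slot and under taking the supremum over the unit
ball in some slots.  This allows an induction on the number of slots, for the moment bound
  ||F - E F||_p <= (1 + K)^d * sum_{I nonempty} p^(#I/2) E sup_I F     (p >= 1):
split F - E F = (F - E_i F) + (E_i F - E F).  Conditionally on the other slots the first term is controlled by
the hypothesis on X, giving K sqrt p ||sup_i F||_p, and sup_i F has one slot less; E_i F has one slot less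
too, and sup_I E_i F <= E_i sup_I F.  Markov's inequality with p = t turns the moment bound into the tail bound.
*)
theory Submission
  imports Defs
begin

section \<open>Functions that are seminorms in each slot\<close>

text \<open>The p-norm of sup_i F is not its mean, so the induction hypothesis serves sup_i F as
  well as E_i F: ||sup_i F||_p is at most E sup_i F plus the p-norm of the deviation. With the extra
  sqrt p, the former function yields exactly the index sets containing i, the latter those without
  i. The step costs a factor K on the one family and 1 on the other; 1 + K dominates both, and its
  powers, being at least 1, absorb the mean of sup_i F.

  The suprema range over uncountable balls, so their measurability is not automatic. Multi-seminorms
  are continuous, and the suprema are again multi-seminorms; this is a reason for working with the
  class instead of with psi. Its members take total families of slots and ignore all but some of
  them, so that removing a slot changes no type.

  Markov's inequality at e times the moment bound produces e^(-t), whence the constant e (1 + K)^d.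
  The event is defined by \<open>\<ge>\<close>, so the argument needs a strictly positive threshold;
  a rank-one tensor at which psi is positive provides it through the term in which all slots are
  replaced.\<close>

definition multi_seminorm :: "nat set \<Rightarrow> nat \<Rightarrow> ((nat \<Rightarrow> nat \<Rightarrow> real) \<Rightarrow> real) \<Rightarrow> bool" where
  "multi_seminorm J n F \<longleftrightarrow>
     (\<forall>x. 0 \<le> F x) \<and>
     (\<forall>x y. (\<forall>i\<in>J. \<forall>j\<in>{1..n}. x i j = y i j) \<longrightarrow> F x = F y) \<and>
     (\<forall>i\<in>J. \<forall>x u v. F (x(i := (\<lambda>j. u j + v j))) \<le> F (x(i := u)) + F (x(i := v))) \<and>
     (\<forall>i\<in>J. \<forall>x c u. F (x(i := (\<lambda>j. c * u j))) \<le> \<bar>c\<bar> * F (x(i := u)))"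

lemma multi_seminormD:
  assumes "multi_seminorm J n F"
  shows multi_seminorm_nonneg: "0 \<le> F x"
    and multi_seminorm_cong: "(\<And>i j. i \<in> J \<Longrightarrow> j \<in> {1..n} \<Longrightarrow> x i j = y i j) \<Longrightarrow> F x = F y"
    and multi_seminorm_add: "i \<in> J \<Longrightarrow> F (x(i := (\<lambda>j. u j + v j))) \<le> F (x(i := u)) + F (x(i := v))"
    and multi_seminorm_scale: "i \<in> J \<Longrightarrow> F (x(i := (\<lambda>j. c * u j))) \<le> \<bar>c\<bar> * F (x(i := u))"
  using assms unfolding multi_seminorm_def by blast+

text \<open>The definition asks only for an upper bound under scaling, the form that passes directly
  to suprema and integrals. Equality returns by rescaling with \<open>inverse c\<close>, and for
  \<open>c = 0\<close> from nonnegativity.\<close>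

lemma multi_seminorm_scale_eq:
  assumes F: "multi_seminorm J n F" and i: "i \<in> J"
  shows "F (x(i := (\<lambda>j. c * u j))) = \<bar>c\<bar> * F (x(i := u))"
proof (cases "c = 0")
  case True
  then show ?thesis
    using multi_seminorm_scale[OF F i, of x 0 u] multi_seminorm_nonneg[OF F, of "x(i := \<lambda>j. 0)"] by simp
next
  case False
  have "F (x(i := u)) \<le> \<bar>inverse c\<bar> * F (x(i := (\<lambda>j. c * u j)))"
    using multi_seminorm_scale[OF F i, of x "inverse c" "\<lambda>j. c * u j"] False by (simp add: mult.assoc[symmetric])
  then have "\<bar>c\<bar> * F (x(i := u)) \<le> F (x(i := (\<lambda>j. c * u j)))"
    using False by (simp add: field_simps)
  then show ?thesis using multi_seminorm_scale[OF F i, of x c u] by simp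
qed

section \<open>Product bound, continuity and measurability of multi-seminorms\<close>

lemma multi_seminorm_fix_slot:
  assumes F: "multi_seminorm J n F"
  shows "multi_seminorm (J - {i}) n (\<lambda>x. F (x(i := u)))"
proof -
  show ?thesis
    unfolding multi_seminorm_def
  proof (intro conjI allI ballI impI)
    show "0 \<le> F (x(i := u))" for x by (rule multi_seminorm_nonneg[OF F])
    show "F (x(i := u)) = F (y(i := u))" if "\<forall>k\<in>J - {i}. \<forall>j\<in>{1..n}. x k j = y k j" for x y
      by (rule multi_seminorm_cong[OF F]) (use that in auto)
    show "F (x(k := \<lambda>j. v j + w j, i := u)) \<le> F (x(k := v, i := u)) + F (x(k := w, i := u))"
      if "k \<in> J - {i}" for k x v w
      using multi_seminorm_add[OF F, of k "x(i := u)" v w] that by (simp add: fun_upd_twist[of k i])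
    show "F (x(k := \<lambda>j. c * v j, i := u)) \<le> \<bar>c\<bar> * F (x(k := v, i := u))" if "k \<in> J - {i}" for k x c v
      using multi_seminorm_scale[OF F, of k "x(i := u)" c v] that by (simp add: fun_upd_twist[of k i])
  qed
qed

text \<open>The truncations of \<open>u\<close> to finite sets \<open>S\<close> of coordinates are
  built up one basis vector at a time. Truncation to \<open>{1..n}\<close> does not change the
  value, because \<open>F\<close> sees only those coordinates.\<close>

lemma multi_seminorm_expand_slot:
  assumes F: "multi_seminorm J n F" and i: "i \<in> J"
  shows "F (x(i := u)) \<le> (\<Sum>j=1..n. \<bar>u j\<bar> * F (x(i := (\<lambda>k. if k = j then 1 else 0))))"
proof -
  have "F (x(i := (\<lambda>k. if k \<in> S then u k else 0))) \<le> (\<Sum>j\<in>S. \<bar>u j\<bar> * F (x(i := (\<lambda>k. if k = j then 1 else 0))))"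
    if "finite S" for S
    using that
  proof (induction S)
    case empty
    show ?case using multi_seminorm_scale[OF F i, of x 0 "\<lambda>_. 0"] by (simp add: fun_upd_def)
  next
    case (insert j S)
    have eq: "(\<lambda>k. if k \<in> insert j S then u k else 0)
        = (\<lambda>k. u j * (if k = j then 1 else 0) + (if k \<in> S then u k else 0))"
      using insert.hyps by (auto simp: fun_eq_iff)
    have "F (x(i := (\<lambda>k. if k \<in> insert j S then u k else 0)))
        \<le> F (x(i := (\<lambda>k. u j * (if k = j then 1 else 0)))) + F (x(i := (\<lambda>k. if k \<in> S then u k else 0)))"
      unfolding eq by (rule multi_seminorm_add[OF F i])
    also have "\<dots> \<le> \<bar>u j\<bar> * F (x(i := (\<lambda>k. if k = j then 1 else 0)))
        + (\<Sum>j\<in>S. \<bar>u j\<bar> * F (x(i := (\<lambda>k. if k = j then 1 else 0))))"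
      by (intro add_mono multi_seminorm_scale[OF F i] insert.IH)
    finally show ?case unfolding sum.insert[OF insert.hyps] .
  qed
  from this[of "{1..n}"] have "F (x(i := (\<lambda>k. if k \<in> {1..n} then u k else 0)))
      \<le> (\<Sum>j=1..n. \<bar>u j\<bar> * F (x(i := (\<lambda>k. if k = j then 1 else 0))))" by simp
  moreover have "F (x(i := (\<lambda>k. if k \<in> {1..n} then u k else 0))) = F (x(i := u))"
    by (rule multi_seminorm_cong[OF F]) auto
  ultimately show ?thesis by simp
qed

text \<open>The basis expansion is iterated over the slots: a basis vector placed in slot
  \<open>i\<close> leaves a function of fewer slots. The bound makes suprema over balls finite and,
  since it vanishes together with any one slot, gives continuity.\<close>

lemma multi_seminorm_bound:
  assumes "finite J" and "multi_seminorm J n F"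
  shows "\<exists>C\<ge>0. \<forall>z. F z \<le> C * (\<Prod>i\<in>J. \<Sum>j=1..n. \<bar>z i j\<bar>)"
  using assms
proof (induction J arbitrary: F)
  case empty
  show ?case
  proof (intro exI[of _ "F (\<lambda>_ _. 0)"] conjI allI)
    show "0 \<le> F (\<lambda>_ _. 0)" by (rule multi_seminorm_nonneg[OF empty])
    have "F z = F (\<lambda>_ _. 0)" for z by (rule multi_seminorm_cong[OF empty]) auto
    then show "F z \<le> F (\<lambda>_ _. 0) * (\<Prod>i\<in>{}. \<Sum>j=1..n. \<bar>z i j\<bar>)" for z
      unfolding prod.empty mult_1_right by (rule eq_refl)
  qed
next
  case (insert i J)
  note F = insert.prems
  define e :: "nat \<Rightarrow> nat \<Rightarrow> real" where "e = (\<lambda>j k. if k = j then 1 else 0)"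
  define P where "P = (\<lambda>z::nat \<Rightarrow> nat \<Rightarrow> real. \<Prod>i\<in>J. \<Sum>j=1..n. \<bar>z i j\<bar>)"
  have P0: "P z \<ge> 0" for z unfolding P_def by (intro prod_nonneg sum_nonneg) auto
  have "multi_seminorm J n (\<lambda>x. F (x(i := e j)))" for j
    using multi_seminorm_fix_slot[OF F, of i "e j"] unfolding Diff_insert_absorb[OF insert.hyps(2)] .
  then have "\<forall>j. \<exists>C\<ge>0. \<forall>z. F (z(i := e j)) \<le> C * P z"
    unfolding P_def using insert.IH by blast
  then obtain C where C: "\<And>j. C j \<ge> 0" "\<And>j z. F (z(i := e j)) \<le> C j * P z" by metis
  \<comment> \<open>Each basis vector comes with its own constant \<open>C j\<close>; the sum of
    these \<open>n\<close> constants serves for all of them.\<close>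
  have Cle: "C j \<le> sum C {1..n}" if "j \<in> {1..n}" for j
    using that C(1) by (intro member_le_sum) auto
  have "F z \<le> sum C {1..n} * (\<Prod>i\<in>insert i J. \<Sum>j=1..n. \<bar>z i j\<bar>)" for z
  proof -
    have "F z = F (z(i := z i))" by simp
    also have "\<dots> \<le> (\<Sum>j=1..n. \<bar>z i j\<bar> * F (z(i := e j)))"
      unfolding e_def by (rule multi_seminorm_expand_slot[OF F]) simp
    also have "\<dots> \<le> (\<Sum>j=1..n. \<bar>z i j\<bar> * (sum C {1..n} * P z))"
      by (intro sum_mono mult_left_mono order.trans[OF C(2)] mult_right_mono Cle P0) auto
    also have "\<dots> = sum C {1..n} * ((\<Sum>j=1..n. \<bar>z i j\<bar>) * P z)"
      unfolding sum_distrib_right[symmetric] by (simp only: mult_ac)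
    finally show ?thesis using insert.hyps by (simp add: P_def)
  qed
  moreover have "sum C {1..n} \<ge> 0" using C(1) by (simp add: sum_nonneg)
  ultimately show ?case by blast
qed

lemma multi_seminorm_diff_slot:
  assumes F: "multi_seminorm J n F" and i: "i \<in> J"
  shows "\<bar>F (x(i := u)) - F (x(i := v))\<bar> \<le> F (x(i := (\<lambda>j. u j - v j)))"
proof -
  have "F (x(i := u)) \<le> F (x(i := (\<lambda>j. u j - v j))) + F (x(i := v))"
    using multi_seminorm_add[OF F i, of x "\<lambda>j. u j - v j" v] by simp
  moreover have "F (x(i := v)) \<le> F (x(i := (\<lambda>j. - 1 * (u j - v j)))) + F (x(i := u))"
    using multi_seminorm_add[OF F i, of x "\<lambda>j. - 1 * (u j - v j)" u] by simp
  ultimately show ?thesis using multi_seminorm_scale[OF F i, of x "-1" "\<lambda>j. u j - v j"] by simp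
qed

text \<open>Telescoping over the slots: \<open>h S y\<close> takes the slots in \<open>S\<close>
  from \<open>y\<close> and the others from \<open>x\<close>. Adding \<open>i\<close> to
  \<open>S\<close> changes \<open>F\<close> by at most its value with \<open>y i - x i\<close> in
  slot \<open>i\<close>. In the product bound that factor tends to 0 while the other factors
  converge.\<close>

lemma multi_seminorm_isCont:
  assumes J: "finite J" and F: "multi_seminorm J n F"
  shows "(F \<longlongrightarrow> F x) (at x)"
proof -
  obtain C where C: "C \<ge> 0" "\<And>z. F z \<le> C * (\<Prod>i\<in>J. \<Sum>j=1..n. \<bar>z i j\<bar>)"
    using multi_seminorm_bound[OF J F] by blast
  have coord: "((\<lambda>y. y i j) \<longlongrightarrow> x i j) (at x)" for i j
  proof -
    have "continuous_on UNIV (\<lambda>y::nat \<Rightarrow> nat \<Rightarrow> real. y i j)"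
      by (rule continuous_on_product_then_coordinatewise[OF continuous_on_product_coordinates])
    then show ?thesis by (auto simp: continuous_on_def)
  qed
  define h where "h = (\<lambda>S y k. if k \<in> S then y k else x k)"
  have "((\<lambda>y. F (h S y)) \<longlongrightarrow> F x) (at x)" if "finite S" "S \<subseteq> J" for S
    using that
  proof (induction S)
    case empty
    show ?case by (simp add: h_def)
  next
    case (insert i S)
    then have i: "i \<in> J" by auto
    let ?d = "\<lambda>y. (h S y)(i := (\<lambda>j. y i j - x i j))"
    have "((\<lambda>y. ?d y k j) \<longlongrightarrow> (if k = i then x i j - x i j else x k j)) (at x)" for k j
    proof (cases "k = i")
      case True
      then show ?thesis using tendsto_diff[OF coord[of i j] tendsto_const[of "x i j"]] by simp
    next
      case False
      then show ?thesis using coord[of k j] by (cases "k \<in> S") (simp_all add: h_def)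
    qed
    then have "((\<lambda>y. C * (\<Prod>k\<in>J. \<Sum>j=1..n. \<bar>?d y k j\<bar>))
        \<longlongrightarrow> C * (\<Prod>k\<in>J. \<Sum>j=1..n. \<bar>if k = i then x i j - x i j else x k j\<bar>)) (at x)"
      by (intro tendsto_mult tendsto_prod tendsto_sum tendsto_rabs tendsto_const)
    moreover have "(\<Prod>k\<in>J. \<Sum>j=1..n. \<bar>if k = i then x i j - x i j else x k j\<bar>) = 0"
      using J i by (intro prod_zero) (auto intro!: bexI[of _ i])
    ultimately have lim0: "((\<lambda>y. C * (\<Prod>k\<in>J. \<Sum>j=1..n. \<bar>?d y k j\<bar>)) \<longlongrightarrow> 0) (at x)" by simp
    have "\<bar>F (h (insert i S) y) - F (h S y)\<bar> \<le> C * (\<Prod>k\<in>J. \<Sum>j=1..n. \<bar>?d y k j\<bar>)" for y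
    proof -
      have "h (insert i S) y = (h S y)(i := y i)" "h S y = (h S y)(i := x i)"
        using insert.hyps by (auto simp: h_def fun_eq_iff)
      then have "\<bar>F (h (insert i S) y) - F (h S y)\<bar> \<le> F (?d y)"
        using multi_seminorm_diff_slot[OF F i, of "h S y" "y i" "x i"] by simp
      also have "\<dots> \<le> C * (\<Prod>k\<in>J. \<Sum>j=1..n. \<bar>?d y k j\<bar>)" by (rule C(2))
      finally show ?thesis .
    qed
    then have "((\<lambda>y. F (h (insert i S) y) - F (h S y)) \<longlongrightarrow> 0) (at x)"
      by (intro Lim_null_comparison[OF _ lim0] always_eventually) simp
    from tendsto_add[OF this insert.IH] insert.prems show ?case by simp
  qed
  from this[OF J subset_refl] have "((\<lambda>y. F (h J y)) \<longlongrightarrow> F x) (at x)" .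
  moreover have "F (h J y) = F y" for y by (rule multi_seminorm_cong[OF F]) (simp add: h_def)
  ultimately show ?thesis by simp
qed

text \<open>Continuity makes \<open>F\<close> Borel on the full product space. Only the coordinates
  seen by \<open>F\<close> are assumed measurable, so \<open>f\<close> is replaced by
  \<open>g\<close>, which is 0 at all other coordinates.\<close>

lemma multi_seminorm_measurable:
  assumes J: "finite J" and F: "multi_seminorm J n F"
    and f: "\<And>i j. i \<in> J \<Longrightarrow> j \<in> {1..n} \<Longrightarrow> (\<lambda>\<omega>. f \<omega> i j) \<in> borel_measurable A"
  shows "(\<lambda>\<omega>. F (f \<omega>)) \<in> borel_measurable A"
proof -
  have Fm: "F \<in> borel_measurable borel"
    by (intro borel_measurable_continuous_onI) (auto simp: continuous_on_def multi_seminorm_isCont[OF J F])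
  define g where "g = (\<lambda>\<omega> i j. if i \<in> J \<and> j \<in> {1..n} then f \<omega> i j else 0)"
  have "g \<in> borel_measurable A"
  proof (intro measurable_coordinatewise_then_product)
    fix i j show "(\<lambda>\<omega>. g \<omega> i j) \<in> borel_measurable A"
      using f[of i j] by (cases "i \<in> J \<and> j \<in> {1..n}") (auto simp: g_def)
  qed
  from measurable_compose[OF this Fm] have "(\<lambda>\<omega>. F (g \<omega>)) \<in> borel_measurable A" .
  moreover have "F (g \<omega>) = F (f \<omega>)" for \<omega> by (rule multi_seminorm_cong[OF F]) (simp add: g_def)
  ultimately show ?thesis by simp
qed

section \<open>Suprema over the unit ball in some of the slots\<close>

definition sup_slots :: "nat \<Rightarrow> nat set \<Rightarrow> ((nat \<Rightarrow> nat \<Rightarrow> real) \<Rightarrow> real) \<Rightarrow> (nat \<Rightarrow> nat \<Rightarrow> real) \<Rightarrow> real" where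
  "sup_slots n I F x = (SUP \<alpha> \<in> I \<rightarrow>\<^sub>E unit_ball n. F (\<lambda>i. if i \<in> I then \<alpha> i else x i))"

lemma zero_in_unit_ball: "(\<lambda>j\<in>{1..n}. 0) \<in> unit_ball n"
  by (auto simp: unit_ball_def coord_space_def L2_set_def)

lemma PiE_unit_ball_nonempty: "I \<rightarrow>\<^sub>E unit_ball n \<noteq> {}"
  using zero_in_unit_ball by (auto simp: PiE_eq_empty_iff)

lemma unit_ball_coord_le:
  assumes "a \<in> unit_ball n" "j \<in> {1..n}"
  shows "\<bar>a j\<bar> \<le> 1"
proof -
  have "\<bar>a j\<bar> \<le> L2_set a {1..n}"
    using member_le_L2_set[of "{1..n}" j "\<lambda>j. \<bar>a j\<bar>"] assms(2) by (simp add: L2_set_def)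
  then show ?thesis using assms(1) by (simp add: unit_ball_def)
qed

text \<open>A real-valued \<open>SUP\<close> is informative only for a set that is bounded above.
  The product bound is uniform in \<open>\<alpha>\<close>, since
  \<open>1 + \<bar>x i j\<bar>\<close> dominates a coordinate whether its slot is replaced or
  kept.\<close>

lemma sup_slots_bdd:
  assumes J: "finite J" and F: "multi_seminorm J n F"
  shows "bdd_above ((\<lambda>\<alpha>. F (\<lambda>i. if i \<in> I then \<alpha> i else x i)) ` (I \<rightarrow>\<^sub>E unit_ball n))"
proof -
  obtain C where C: "C \<ge> 0" "\<And>z. F z \<le> C * (\<Prod>i\<in>J. \<Sum>j=1..n. \<bar>z i j\<bar>)"
    using multi_seminorm_bound[OF J F] by blast
  show ?thesis
  proof (rule bdd_aboveI2)
    fix \<alpha> assume \<alpha>: "\<alpha> \<in> I \<rightarrow>\<^sub>E unit_ball n"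
    have "F (\<lambda>i. if i \<in> I then \<alpha> i else x i) \<le> C * (\<Prod>i\<in>J. \<Sum>j=1..n. \<bar>(if i \<in> I then \<alpha> i else x i) j\<bar>)"
      by (rule C(2))
    also have "\<dots> \<le> C * (\<Prod>i\<in>J. \<Sum>j=1..n. (1 + \<bar>x i j\<bar>))"
    proof (intro mult_left_mono prod_mono conjI sum_mono sum_nonneg C(1))
      fix i j assume "i \<in> J" "j \<in> {1..n}"
      show "\<bar>(if i \<in> I then \<alpha> i else x i) j\<bar> \<le> 1 + \<bar>x i j\<bar>"
        using unit_ball_coord_le[of "\<alpha> i" n j] \<alpha> \<open>j \<in> {1..n}\<close> by (auto simp: PiE_iff)
    qed auto
    finally show "F (\<lambda>i. if i \<in> I then \<alpha> i else x i) \<le> C * (\<Prod>i\<in>J. \<Sum>j=1..n. (1 + \<bar>x i j\<bar>))" .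
  qed
qed

lemma sup_slots_upper:
  assumes "finite J" and "multi_seminorm J n F" and "\<alpha> \<in> I \<rightarrow>\<^sub>E unit_ball n"
  shows "F (\<lambda>i. if i \<in> I then \<alpha> i else x i) \<le> sup_slots n I F x"
  unfolding sup_slots_def by (rule cSUP_upper[OF assms(3) sup_slots_bdd[OF assms(1,2)]])

lemma sup_slots_least:
  assumes "\<And>\<alpha>. \<alpha> \<in> I \<rightarrow>\<^sub>E unit_ball n \<Longrightarrow> F (\<lambda>i. if i \<in> I then \<alpha> i else x i) \<le> B"
  shows "sup_slots n I F x \<le> B"
  unfolding sup_slots_def using assms by (intro cSUP_least PiE_unit_ball_nonempty) auto

text \<open>For a fixed \<open>\<alpha>\<close> the inequalities are those of \<open>F\<close> at a
  slot outside \<open>I\<close>, and they survive the supremum. The link is \<open>upd\<close>: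
  changing a slot outside \<open>I\<close> commutes with overwriting the slots in
  \<open>I\<close>.\<close>

lemma multi_seminorm_sup_slots:
  assumes J: "finite J" and F: "multi_seminorm J n F"
  shows "multi_seminorm (J - I) n (sup_slots n I F)"
proof -
  note up = sup_slots_upper[OF J F] and lst = sup_slots_least
  have upd: "(\<lambda>k. if k \<in> I then \<alpha> k else (x(i := u)) k) = (\<lambda>k. if k \<in> I then \<alpha> k else x k)(i := u)"
    if "i \<notin> I" for i u x and \<alpha> :: "nat \<Rightarrow> nat \<Rightarrow> real"
    using that by (auto simp: fun_eq_iff)
  show ?thesis
    unfolding multi_seminorm_def
  proof (intro conjI allI ballI impI)
    fix x
    obtain \<alpha> where "\<alpha> \<in> I \<rightarrow>\<^sub>E unit_ball n" using PiE_unit_ball_nonempty[of I n] by blast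
    from up[OF this, of x] show "0 \<le> sup_slots n I F x"
      using multi_seminorm_nonneg[OF F] by (rule order.trans[rotated])
  next
    fix x y :: "nat \<Rightarrow> nat \<Rightarrow> real" assume "\<forall>i\<in>J - I. \<forall>j\<in>{1..n}. x i j = y i j"
    then show "sup_slots n I F x = sup_slots n I F y"
      unfolding sup_slots_def by (intro SUP_cong refl multi_seminorm_cong[OF F]) auto
  next
    fix i x u v assume i: "i \<in> J - I"
    then have iI: "i \<notin> I" and iJ: "i \<in> J" by auto
    show "sup_slots n I F (x(i := \<lambda>j. u j + v j)) \<le> sup_slots n I F (x(i := u)) + sup_slots n I F (x(i := v))"
    proof (rule lst)
      fix \<alpha> assume \<alpha>: "\<alpha> \<in> I \<rightarrow>\<^sub>E unit_ball n"
      show "F (\<lambda>k. if k \<in> I then \<alpha> k else (x(i := \<lambda>j. u j + v j)) k)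
          \<le> sup_slots n I F (x(i := u)) + sup_slots n I F (x(i := v))"
        using up[OF \<alpha>, of "x(i := u)"] up[OF \<alpha>, of "x(i := v)"]
          multi_seminorm_add[OF F iJ, of "\<lambda>k. if k \<in> I then \<alpha> k else x k" u v]
        unfolding upd[OF iI] by linarith
    qed
  next
    fix i x c u assume i: "i \<in> J - I"
    then have iI: "i \<notin> I" and iJ: "i \<in> J" by auto
    show "sup_slots n I F (x(i := \<lambda>j. c * u j)) \<le> \<bar>c\<bar> * sup_slots n I F (x(i := u))"
    proof (rule lst)
      fix \<alpha> assume \<alpha>: "\<alpha> \<in> I \<rightarrow>\<^sub>E unit_ball n"
      have "F (\<lambda>k. if k \<in> I then \<alpha> k else (x(i := \<lambda>j. c * u j)) k)
          \<le> \<bar>c\<bar> * F (\<lambda>k. if k \<in> I then \<alpha> k else (x(i := u)) k)"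
        unfolding upd[OF iI] by (rule multi_seminorm_scale[OF F iJ])
      also have "\<dots> \<le> \<bar>c\<bar> * sup_slots n I F (x(i := u))"
        by (intro mult_left_mono up[OF \<alpha>]) auto
      finally show "F (\<lambda>k. if k \<in> I then \<alpha> k else (x(i := \<lambda>j. c * u j)) k) \<le> \<bar>c\<bar> * sup_slots n I F (x(i := u))" .
    qed
  qed
qed

text \<open>The bridge to the hypothesis on \<open>X\<close>, which concerns seminorms of
  extensional vectors. Restricting a vector to \<open>{1..n}\<close> is harmless because
  \<open>F\<close> reads no other coordinate.\<close>

lemma seminorm_on_slot:
  assumes F: "multi_seminorm J n F" and i: "i \<in> J"
  shows "seminorm_on {1..n} (\<lambda>u. F (x(i := u)))"
  unfolding seminorm_on_def
proof (intro conjI ballI allI)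
  fix u v :: "nat \<Rightarrow> real" and c :: real
  show "0 \<le> F (x(i := u))" by (rule multi_seminorm_nonneg[OF F])
  have "F (x(i := \<lambda>j\<in>{1..n}. u j + v j)) = F (x(i := \<lambda>j. u j + v j))"
    by (rule multi_seminorm_cong[OF F]) auto
  then show "F (x(i := \<lambda>j\<in>{1..n}. u j + v j)) \<le> F (x(i := u)) + F (x(i := v))"
    using multi_seminorm_add[OF F i, of x u v] by simp
  have "F (x(i := \<lambda>j\<in>{1..n}. c * u j)) = F (x(i := \<lambda>j. c * u j))"
    by (rule multi_seminorm_cong[OF F]) auto
  then show "F (x(i := \<lambda>j\<in>{1..n}. c * u j)) = \<bar>c\<bar> * F (x(i := u))"
    using multi_seminorm_scale_eq[OF F i, of x c u] by simp
qed

lemma SUP_slot_le_sup_slots: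
  assumes "finite J" and F: "multi_seminorm J n F"
  shows "(SUP a\<in>unit_ball n. F (x(i := a))) \<le> sup_slots n {i} F x"
proof (rule cSUP_least)
  show "unit_ball n \<noteq> {}" using zero_in_unit_ball by blast
  fix a assume a: "a \<in> unit_ball n"
  have eq: "x(i := a) = (\<lambda>k. if k \<in> {i} then (\<lambda>k\<in>{i}. a) k else x k)" by (auto simp: fun_eq_iff)
  show "F (x(i := a)) \<le> sup_slots n {i} F x"
    unfolding eq by (rule sup_slots_upper[OF assms]) (use a in auto)
qed

text \<open>A choice for the slots in \<open>I\<close> followed by one for slot \<open>i\<close> is
  a single choice for \<open>insert i I\<close>. Through this inequality the recursion on
  \<open>sup_slots n {i} F\<close> reaches the index sets that contain \<open>i\<close>.\<close>

lemma sup_slots_nested_le: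
  assumes J: "finite J" and F: "multi_seminorm J n F" and i: "i \<notin> I"
  shows "sup_slots n I (sup_slots n {i} F) x \<le> sup_slots n (insert i I) F x"
proof (intro sup_slots_least)
  fix \<alpha> \<beta> assume \<alpha>: "\<alpha> \<in> I \<rightarrow>\<^sub>E unit_ball n" and \<beta>: "\<beta> \<in> {i} \<rightarrow>\<^sub>E unit_ball n"
  have eq: "(\<lambda>k. if k \<in> {i} then \<beta> k else if k \<in> I then \<alpha> k else x k)
      = (\<lambda>k. if k \<in> insert i I then (\<alpha>(i := \<beta> i)) k else x k)"
    using i by (auto simp: fun_eq_iff)
  have "\<alpha>(i := \<beta> i) \<in> insert i I \<rightarrow>\<^sub>E unit_ball n"
    using \<alpha> \<beta> by (auto simp: PiE_iff extensional_def)
  then show "F (\<lambda>k. if k \<in> {i} then \<beta> k else if k \<in> I then \<alpha> k else x k) \<le> sup_slots n (insert i I) F x"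
    unfolding eq by (rule sup_slots_upper[OF J F])
qed

lemma sup_slots_empty: "sup_slots n {} F = F"
  by (simp add: sup_slots_def fun_eq_iff)

section \<open>Moment bound\<close>

lemma convex_powr_le:
  fixes a b l p :: real
  assumes "a \<ge> 0" "b \<ge> 0" "0 \<le> l" "l \<le> 1" "p \<ge> 1"
  shows "(l * a + (1 - l) * b) powr p \<le> l * a powr p + (1 - l) * b powr p"
proof -
  \<comment> \<open>Convexity of \<open>powr\<close> is invoked for positive \<open>a\<close> and
    \<open>b\<close> only. If one of them is 0, the claim reduces to this scaling inequality, which
    holds because \<open>m powr p \<le> m\<close> on the unit interval.\<close>
  have shrink: "(m * c) powr p \<le> m * c powr p" if "0 \<le> m" "m \<le> 1" "0 \<le> c" for m c :: real
  proof (cases "m = 0")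
    case False
    then have "m powr p \<le> m powr 1" using that assms by (intro powr_mono') auto
    then show ?thesis using that by (auto simp: powr_mult intro!: mult_right_mono)
  qed simp
  show ?thesis
  proof (cases "a = 0 \<or> b = 0")
    case True
    then show ?thesis using shrink[of "1 - l" b] shrink[of l a] assms by auto
  next
    case False
    then show ?thesis
      using convex_onD[OF powr_convex[OF \<open>p \<ge> 1\<close>], of l b a] assms by (simp add: algebra_simps)
  qed
qed

text \<open>Stated through p-th powers, so that no root of a possibly infinite integral occurs. With
  weights proportional to the two bounds, the sum of the absolute values is a multiple of a convex
  combination of the normalized functions, and convexity of the p-th power is integrated.\<close>

lemma Minkowski_powr:
  fixes f g :: "'a \<Rightarrow> real"
  assumes [measurable]: "f \<in> borel_measurable M" "g \<in> borel_measurable M"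
    and p: "p \<ge> 1" and AB: "A \<ge> 0" "B \<ge> 0"
    and f: "(\<integral>\<^sup>+x. ennreal (\<bar>f x\<bar> powr p) \<partial>M) \<le> ennreal (A powr p)"
    and g: "(\<integral>\<^sup>+x. ennreal (\<bar>g x\<bar> powr p) \<partial>M) \<le> ennreal (B powr p)"
  shows "(\<integral>\<^sup>+x. ennreal (\<bar>f x + g x\<bar> powr p) \<partial>M) \<le> ennreal ((A + B) powr p)"
proof -
  \<comment> \<open>Normalization divides by the bounds, and \<open>A\<close> or \<open>B\<close>
    may be 0. The inequality is therefore shown for strictly larger \<open>A'\<close> and
    \<open>B'\<close>, which afterwards decrease to \<open>A\<close> and \<open>B\<close>.\<close>
  have pos: "(\<integral>\<^sup>+x. ennreal (\<bar>f x + g x\<bar> powr p) \<partial>M) \<le> ennreal ((A' + B') powr p)"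
    if "A' > A" "B' > B" for A' B'
  proof -
    have A': "A' > 0" and B': "B' > 0" using that AB by auto
    define l where "l = A' / (A' + B')"
    have l: "0 \<le> l" "l \<le> 1" and l': "1 - l = B' / (A' + B')" using A' B' by (auto simp: l_def field_simps)
    have ptw: "\<bar>f x + g x\<bar> powr p
        \<le> (A' + B') powr p * (l * (\<bar>f x\<bar> powr p / A' powr p) + (1 - l) * (\<bar>g x\<bar> powr p / B' powr p))" for x
    proof -
      have eq: "(\<bar>f x\<bar> + \<bar>g x\<bar>) = (A' + B') * (l * (\<bar>f x\<bar> / A') + (1 - l) * (\<bar>g x\<bar> / B'))"
        unfolding l' using A' B' by (simp add: l_def distrib_left)
      have "\<bar>f x + g x\<bar> powr p \<le> (\<bar>f x\<bar> + \<bar>g x\<bar>) powr p" using p by (intro powr_mono2) auto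
      also have "\<dots> = (A' + B') powr p * (l * (\<bar>f x\<bar> / A') + (1 - l) * (\<bar>g x\<bar> / B')) powr p"
        unfolding eq by (rule powr_mult)
      also have "\<dots> \<le> (A' + B') powr p * (l * (\<bar>f x\<bar> / A') powr p + (1 - l) * (\<bar>g x\<bar> / B') powr p)"
        using A' B' l p by (intro mult_left_mono convex_powr_le) auto
      finally show ?thesis using A' B' by (simp add: powr_divide)
    qed
    have "(\<integral>\<^sup>+x. ennreal (\<bar>f x + g x\<bar> powr p) \<partial>M)
        \<le> (\<integral>\<^sup>+x. ennreal ((A' + B') powr p * l / A' powr p) * ennreal (\<bar>f x\<bar> powr p)
              + ennreal ((A' + B') powr p * (1 - l) / B' powr p) * ennreal (\<bar>g x\<bar> powr p) \<partial>M)"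
    proof (rule nn_integral_mono)
      fix x
      have "ennreal (\<bar>f x + g x\<bar> powr p) \<le> ennreal ((A' + B') powr p * l / A' powr p * \<bar>f x\<bar> powr p
          + (A' + B') powr p * (1 - l) / B' powr p * \<bar>g x\<bar> powr p)"
        using ptw[of x] by (intro ennreal_leI) (simp add: distrib_left)
      then show "ennreal (\<bar>f x + g x\<bar> powr p)
          \<le> ennreal ((A' + B') powr p * l / A' powr p) * ennreal (\<bar>f x\<bar> powr p)
              + ennreal ((A' + B') powr p * (1 - l) / B' powr p) * ennreal (\<bar>g x\<bar> powr p)"
        using l by (simp add: ennreal_mult'[symmetric])
    qed
    also have "\<dots> = ennreal ((A' + B') powr p * l / A' powr p) * (\<integral>\<^sup>+x. ennreal (\<bar>f x\<bar> powr p) \<partial>M)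
              + ennreal ((A' + B') powr p * (1 - l) / B' powr p) * (\<integral>\<^sup>+x. ennreal (\<bar>g x\<bar> powr p) \<partial>M)"
      by (simp add: nn_integral_add nn_integral_cmult)
    also have "\<dots> \<le> ennreal ((A' + B') powr p * l / A' powr p) * ennreal (A' powr p)
              + ennreal ((A' + B') powr p * (1 - l) / B' powr p) * ennreal (B' powr p)"
      using that AB p by (intro add_mono mult_left_mono order.trans[OF f] order.trans[OF g] ennreal_leI powr_mono2) auto
    also have "\<dots> = ennreal ((A' + B') powr p * l) + ennreal ((A' + B') powr p * (1 - l))"
      using A' B' l by (simp add: ennreal_mult[symmetric])
    also have "\<dots> = ennreal ((A' + B') powr p)"
      using l by (simp add: ennreal_plus[symmetric] distrib_left[symmetric] del: ennreal_plus)
    finally show ?thesis .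
  qed
  have "((\<lambda>e. ennreal ((A + e + (B + e)) powr p)) \<longlongrightarrow> ennreal ((A + 0 + (B + 0)) powr p)) (at_right 0)"
    using p AB by (intro tendsto_ennrealI tendsto_powr' tendsto_intros) (auto intro!: eventually_mono[OF eventually_at_right_less])
  moreover have "\<forall>\<^sub>F e in at_right 0. (\<integral>\<^sup>+x. ennreal (\<bar>f x + g x\<bar> powr p) \<partial>M) \<le> ennreal ((A + e + (B + e)) powr p)"
    by (rule eventually_mono[OF eventually_at_right_less]) (intro pos; simp)
  ultimately have "(\<integral>\<^sup>+x. ennreal (\<bar>f x + g x\<bar> powr p) \<partial>M) \<le> ennreal ((A + 0 + (B + 0)) powr p)"
    by (rule tendsto_lowerbound) (rule trivial_limit_at_right_real)
  then show ?thesis by simp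
qed

text \<open>The law of one copy. The deviation hypothesis is in p-th powers, to fit
  \<open>Minkowski_powr\<close>, and has the ball in place of the sphere, to fit
  \<open>sup_slots\<close>; for \<open>n \<ge> 1\<close> this supremum is at least the one over the
  sphere, so the hypothesis on \<open>X\<close> implies this form.\<close>

locale concentrated = prob_space \<mu>
  for \<mu> :: "(nat \<Rightarrow> real) measure" +
  fixes n :: nat and K :: real
  assumes sets_\<mu>: "sets \<mu> = sets (PiM {1..n} (\<lambda>_. borel))"
    and K_nonneg: "K \<ge> 0"
    and seminorm_integrable: "seminorm_on {1..n} \<phi> \<Longrightarrow> integrable \<mu> \<phi>"
    and seminorm_deviation: "seminorm_on {1..n} \<phi> \<Longrightarrow> p \<ge> 1 \<Longrightarrow>
      (\<integral>\<^sup>+u. ennreal (\<bar>\<phi> u - (\<integral>v. \<phi> v \<partial>\<mu>)\<bar> powr p) \<partial>\<mu>)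
        \<le> ennreal ((K * sqrt p * (SUP a\<in>unit_ball n. \<phi> a)) powr p)"
begin

section \<open>Averaging over one slot under the product law\<close>

sublocale product_sigma_finite "\<lambda>_::nat. \<mu>"
  by unfold_locales

abbreviation P :: "nat set \<Rightarrow> (nat \<Rightarrow> nat \<Rightarrow> real) measure" where
  "P J \<equiv> PiM J (\<lambda>_. \<mu>)"

text \<open>E_i of the overview: the conditional expectation given the other slots, kept as a
  function of all slots that ignores slot \<open>i\<close>.\<close>

definition mean_slot :: "nat \<Rightarrow> ((nat \<Rightarrow> nat \<Rightarrow> real) \<Rightarrow> real) \<Rightarrow> (nat \<Rightarrow> nat \<Rightarrow> real) \<Rightarrow> real" where
  "mean_slot i F x = (\<integral>u. F (x(i := u)) \<partial>\<mu>)"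

lemma prob_space_P: "prob_space (P J)"
  by (intro prob_space_PiM) unfold_locales

lemma measurable_coordinate:
  assumes "j \<in> {1..n}" shows "(\<lambda>u. u j) \<in> borel_measurable \<mu>"
  unfolding measurable_cong_sets[OF sets_\<mu> refl]
  by (rule measurable_component_singleton[OF assms])

text \<open>\<open>J\<^sub>0\<close> may be smaller than \<open>J\<close>: averages and suprema lose
  slots but may still be integrated over the full product.\<close>

lemma measurable_P:
  assumes "finite J" "J\<^sub>0 \<subseteq> J" "multi_seminorm J\<^sub>0 n F"
  shows "F \<in> borel_measurable (P J)"
proof (rule multi_seminorm_measurable[OF finite_subset[OF assms(2,1)] assms(3)])
  fix i j assume "i \<in> J\<^sub>0" "j \<in> {1..n}"
  then have ij: "i \<in> J" "j \<in> {1..n}" using assms(2) by auto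
  show "(\<lambda>x. x i j) \<in> borel_measurable (P J)"
    using measurable_compose[OF measurable_component_singleton[OF ij(1), of "\<lambda>_. \<mu>"] measurable_coordinate[OF ij(2)]] .
qed

lemma multi_seminorm_upd_notin:
  assumes F: "multi_seminorm J\<^sub>0 n F" and "i \<notin> J\<^sub>0"
  shows "F (x(i := u)) = F x"
  by (rule multi_seminorm_cong[OF F]) (use assms(2) in auto)

lemma mean_slot_notin:
  assumes "multi_seminorm J\<^sub>0 n F" and "i \<notin> J\<^sub>0"
  shows "mean_slot i F x = F x"
  by (simp add: mean_slot_def multi_seminorm_upd_notin[OF assms] prob_space)

lemma slot_integrable:
  assumes F: "multi_seminorm J\<^sub>0 n F"
  shows "integrable \<mu> (\<lambda>u. F (x(i := u)))"
proof (cases "i \<in> J\<^sub>0")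
  case True
  then show ?thesis by (intro seminorm_integrable seminorm_on_slot[OF F])
next
  case False
  then show ?thesis by (simp add: multi_seminorm_upd_notin[OF F])
qed

lemma multi_seminorm_mean_slot:
  assumes F: "multi_seminorm J n F"
  shows "multi_seminorm (J - {i}) n (mean_slot i F)"
  unfolding multi_seminorm_def mean_slot_def
proof (intro conjI allI ballI impI)
  note fix_slot = multi_seminorm_fix_slot[OF F, of i]
  show "0 \<le> (\<integral>u. F (x(i := u)) \<partial>\<mu>)" for x
    by (intro integral_nonneg_AE AE_I2 multi_seminorm_nonneg[OF F])
  show "(\<integral>u. F (x(i := u)) \<partial>\<mu>) = (\<integral>u. F (y(i := u)) \<partial>\<mu>)"
    if "\<forall>k\<in>J - {i}. \<forall>j\<in>{1..n}. x k j = y k j" for x y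
    by (intro Bochner_Integration.integral_cong refl multi_seminorm_cong[OF fix_slot]) (use that in auto)
  fix k x v w and c :: real assume k: "k \<in> J - {i}"
  show "(\<integral>u. F (x(k := \<lambda>j. v j + w j, i := u)) \<partial>\<mu>)
      \<le> (\<integral>u. F (x(k := v, i := u)) \<partial>\<mu>) + (\<integral>u. F (x(k := w, i := u)) \<partial>\<mu>)"
    by (subst Bochner_Integration.integral_add[symmetric])
       (intro slot_integrable[OF F] integral_mono Bochner_Integration.integrable_add multi_seminorm_add[OF fix_slot k])+
  show "(\<integral>u. F (x(k := \<lambda>j. c * v j, i := u)) \<partial>\<mu>) \<le> \<bar>c\<bar> * (\<integral>u. F (x(k := v, i := u)) \<partial>\<mu>)"
    by (subst Bochner_Integration.integral_mult_right_zero[symmetric])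
       (intro slot_integrable[OF F] integral_mono integrable_mult_right multi_seminorm_scale[OF fix_slot k])+
qed

text \<open>By Tonelli, integrating out slot \<open>i\<close> turns \<open>F\<close> into
  \<open>mean_slot i F\<close>, which is in the class again and has fewer slots to integrate.
  Finiteness thus goes back to the integrability of seminorms of a single vector.\<close>

lemma integrable_P:
  assumes "finite J" "J\<^sub>0 \<subseteq> J" "multi_seminorm J\<^sub>0 n F"
  shows "integrable (P J) F"
  using assms
proof (induction J arbitrary: J\<^sub>0 F)
  case empty
  then show ?case by (simp add: PiM_empty integrable_count_space)
next
  case (insert i J)
  note F = insert.prems(2)
  have meas: "F \<in> borel_measurable (P (insert i J))"
    using insert by (intro measurable_P) auto
  have mean: "integrable (P J) (mean_slot i F)"
    by (rule insert.IH[OF _ multi_seminorm_mean_slot[OF F]]) (use insert.prems(1) in auto)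
  have "(\<integral>\<^sup>+x. ennreal (norm (F x)) \<partial>P (insert i J)) = (\<integral>\<^sup>+x. \<integral>\<^sup>+u. ennreal (F (x(i := u))) \<partial>\<mu> \<partial>P J)"
    using meas insert.hyps multi_seminorm_nonneg[OF F] by (subst product_nn_integral_insert) auto
  also have "\<dots> = (\<integral>\<^sup>+x. ennreal (norm (mean_slot i F x)) \<partial>P J)"
  proof (rule nn_integral_cong)
    fix x
    have "(\<integral>\<^sup>+u. ennreal (F (x(i := u))) \<partial>\<mu>) = ennreal (mean_slot i F x)"
      unfolding mean_slot_def
      by (intro nn_integral_eq_integral slot_integrable[OF F] AE_I2 multi_seminorm_nonneg[OF F])
    then show "(\<integral>\<^sup>+u. ennreal (F (x(i := u))) \<partial>\<mu>) = ennreal (norm (mean_slot i F x))"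
      using multi_seminorm_nonneg[OF multi_seminorm_mean_slot[OF F, of i], of x] by simp
  qed
  also have "\<dots> < \<infinity>" using mean unfolding integrable_iff_bounded by simp
  finally show ?case by (intro integrableI_bounded meas)
qed

lemma integral_P_insert:
  assumes "finite J" "i \<notin> J" "J\<^sub>0 \<subseteq> insert i J" "multi_seminorm J\<^sub>0 n F"
  shows "(\<integral>x. F x \<partial>P (insert i J)) = (\<integral>x. mean_slot i F x \<partial>P J)"
  unfolding mean_slot_def
  by (intro product_integral_insert integrable_P[OF _ assms(3,4)]) (use assms in auto)

lemma integral_sup_slots_mean_le:
  assumes J: "finite J" "i \<notin> J" and F: "multi_seminorm (insert i J) n F" and I: "I \<subseteq> J"
  shows "(\<integral>x. sup_slots n I (mean_slot i F) x \<partial>P J) \<le> (\<integral>x. sup_slots n I F x \<partial>P (insert i J))"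
proof -
  have fin: "finite (insert i J)" using J by simp
  have iI: "i \<notin> I" using I J by auto
  note sF = multi_seminorm_sup_slots[OF fin F, of I]
  have mF: "multi_seminorm J n (mean_slot i F)"
    using multi_seminorm_mean_slot[OF F, of i] J by simp
  have ptw: "sup_slots n I (mean_slot i F) x \<le> mean_slot i (sup_slots n I F) x" for x
  proof (rule sup_slots_least)
    fix \<alpha> assume \<alpha>: "\<alpha> \<in> I \<rightarrow>\<^sub>E unit_ball n"
    have "(\<lambda>k. if k \<in> I then \<alpha> k else x k)(i := u) = (\<lambda>k. if k \<in> I then \<alpha> k else (x(i := u)) k)" for u
      using iI by (auto simp: fun_eq_iff)
    then show "mean_slot i F (\<lambda>k. if k \<in> I then \<alpha> k else x k) \<le> mean_slot i (sup_slots n I F) x"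
      unfolding mean_slot_def
      using sup_slots_upper[OF fin F \<alpha>] by (intro integral_mono slot_integrable[OF F] slot_integrable[OF sF]) simp
  qed
  have "(\<integral>x. sup_slots n I (mean_slot i F) x \<partial>P J) \<le> (\<integral>x. mean_slot i (sup_slots n I F) x \<partial>P J)"
    by (intro integral_mono ptw integrable_P[OF J(1) _ multi_seminorm_sup_slots[OF J(1) mF]]
          integrable_P[OF J(1) _ multi_seminorm_mean_slot[OF sF]]) auto
  also have "\<dots> = (\<integral>x. sup_slots n I F x \<partial>P (insert i J))"
    by (rule integral_P_insert[OF J _ sF, symmetric]) auto
  finally show ?thesis .
qed

lemma integral_sup_slots_sup_le:
  assumes J: "finite J" "i \<notin> J" and F: "multi_seminorm (insert i J) n F" and I: "I \<subseteq> J"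
  shows "(\<integral>x. sup_slots n I (sup_slots n {i} F) x \<partial>P J) \<le> (\<integral>x. sup_slots n (insert i I) F x \<partial>P (insert i J))"
proof -
  have fin: "finite (insert i J)" using J by simp
  have iI: "i \<notin> I" using I J by auto
  note sF = multi_seminorm_sup_slots[OF fin F, of "insert i I"]
  have gF: "multi_seminorm J n (sup_slots n {i} F)"
    using multi_seminorm_sup_slots[OF fin F, of "{i}"] J by simp
  have "(\<integral>x. sup_slots n I (sup_slots n {i} F) x \<partial>P J) \<le> (\<integral>x. sup_slots n (insert i I) F x \<partial>P J)"
    by (intro integral_mono sup_slots_nested_le[OF fin F iI]
          integrable_P[OF J(1) _ multi_seminorm_sup_slots[OF J(1) gF]] integrable_P[OF J(1) _ sF]) auto
  \<comment> \<open>The integrand ignores slot \<open>i\<close>, so averaging over that slot leaves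
    it unchanged and the integral can be moved to the larger product.\<close>
  also have "\<dots> = (\<integral>x. mean_slot i (sup_slots n (insert i I) F) x \<partial>P J)"
    by (intro Bochner_Integration.integral_cong refl mean_slot_notin[OF sF, symmetric]) auto
  also have "\<dots> = (\<integral>x. sup_slots n (insert i I) F x \<partial>P (insert i J))"
    by (rule integral_P_insert[OF J _ sF, symmetric]) auto
  finally show ?thesis .
qed

lemma integral_sup_slots_nonneg:
  assumes J: "finite J" and F: "multi_seminorm J n F"
  shows "0 \<le> (\<integral>x. sup_slots n I F x \<partial>M)"
  by (intro integral_nonneg_AE AE_I2 multi_seminorm_nonneg[OF multi_seminorm_sup_slots[OF J F]])

theorem moment_bound:
  assumes p: "p \<ge> 1" and "finite J" and "multi_seminorm J n F"
  shows "(\<integral>\<^sup>+x. ennreal (\<bar>F x - (\<integral>y. F y \<partial>P J)\<bar> powr p) \<partial>P J)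
    \<le> ennreal (((1 + K) ^ card J *
        (\<Sum>I\<in>Pow J - {{}}. p powr (real (card I) / 2) * (\<integral>x. sup_slots n I F x \<partial>P J))) powr p)"
  using assms(2,3)
proof (induction J arbitrary: F)
  case empty
  interpret E: prob_space "P {}" by (rule prob_space_P)
  \<comment> \<open>With no slots \<open>F\<close> is constant, so its deviation is 0, matching the
    empty sum in the bound.\<close>
  have F: "F x = F (\<lambda>_ _. 0)" for x by (rule multi_seminorm_cong[OF empty]) auto
  have "(\<integral>y. F y \<partial>P {}) = (\<integral>y. F (\<lambda>_ _. 0) \<partial>P {})"
    by (intro Bochner_Integration.integral_cong refl F)
  also have "\<dots> = F (\<lambda>_ _. 0)" by (simp add: E.prob_space)
  finally have diff: "F x - (\<integral>y. F y \<partial>P {}) = 0" for x by (metis F diff_self)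
  show ?case unfolding diff by simp
next
  case (insert i J)
  note J = insert.hyps and F = insert.prems
  have fin: "finite (insert i J)" using J by simp
  interpret PJ: prob_space "P J" by (rule prob_space_P)
  define g where "g = sup_slots n {i} F"
  define m where "m = mean_slot i F"
  define w where "w = (\<lambda>I. p powr (real (card (I :: nat set)) / 2))"
  define E where "E = (\<lambda>I. \<integral>x. sup_slots n I F x \<partial>P (insert i J))"
  define C where "C = (1 + K) ^ card J"
  have C: "C \<ge> 1" unfolding C_def using K_nonneg by (intro one_le_power) simp
  have w0: "w I \<ge> 0" for I by (simp add: w_def)
  have E0: "E I \<ge> 0" for I unfolding E_def by (rule integral_sup_slots_nonneg[OF fin F])
  have gF: "multi_seminorm J n g"
    using multi_seminorm_sup_slots[OF fin F, of "{i}"] J by (simp add: g_def)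
  have mF: "multi_seminorm J n m"
    using multi_seminorm_mean_slot[OF F, of i] J by (simp add: m_def)
  have meas: "F \<in> borel_measurable (P (insert i J))" "m \<in> borel_measurable (P (insert i J))"
      "m \<in> borel_measurable (P J)" "g \<in> borel_measurable (P J)"
    using measurable_P[OF fin _ F] measurable_P[OF fin _ mF] measurable_P[OF J(1) _ mF] measurable_P[OF J(1) _ gF]
    by auto
  note [measurable] = meas
  have m_upd: "m (x(i := u)) = m x" for x u by (simp add: m_def mean_slot_def)
  have EF: "(\<integral>y. F y \<partial>P (insert i J)) = (\<integral>y. m y \<partial>P J)"
    unfolding m_def by (rule integral_P_insert[OF J _ F]) simp

  \<comment> \<open>\<open>Bg\<close> has to bound the p-norm of \<open>g\<close> itself, hence its
    sum includes \<open>{}\<close>, whose term carries the mean of \<open>g\<close>.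
    \<open>B2\<close> bounds only the deviation of \<open>m\<close> from its mean, so
    \<open>{}\<close> is left out.\<close>
  define Bg where "Bg = C * (\<Sum>I\<in>Pow J. w I * (\<integral>x. sup_slots n I g x \<partial>P J))"
  define B2 where "B2 = C * (\<Sum>I\<in>Pow J - {{}}. w I * (\<integral>x. sup_slots n I m x \<partial>P J))"
  have sg0: "0 \<le> (\<integral>x. sup_slots n I g x \<partial>P J)" for I by (rule integral_sup_slots_nonneg[OF J(1) gF])
  have sm0: "0 \<le> (\<integral>x. sup_slots n I m x \<partial>P J)" for I by (rule integral_sup_slots_nonneg[OF J(1) mF])
  have Eg0: "0 \<le> (\<integral>y. g y \<partial>P J)" using sg0[of "{}"] by (simp add: sup_slots_empty)
  have B0: "Bg \<ge> 0" "B2 \<ge> 0" unfolding Bg_def B2_def using C by (intro mult_nonneg_nonneg sum_nonneg w0 sg0 sm0; simp)+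
  have g_moment: "(\<integral>\<^sup>+x. ennreal (g x powr p) \<partial>P J) \<le> ennreal (Bg powr p)"
  proof -
    let ?D = "C * (\<Sum>I\<in>Pow J - {{}}. w I * (\<integral>x. sup_slots n I g x \<partial>P J))"
    have "(\<integral>\<^sup>+x. ennreal (\<bar>(g x - (\<integral>y. g y \<partial>P J)) + (\<integral>y. g y \<partial>P J)\<bar> powr p) \<partial>P J)
        \<le> ennreal ((?D + (\<integral>y. g y \<partial>P J)) powr p)"
    proof (rule Minkowski_powr[OF _ _ p])
      show "?D \<ge> 0" using C by (intro mult_nonneg_nonneg sum_nonneg w0 sg0) auto
      show "(\<integral>\<^sup>+x. ennreal (\<bar>g x - (\<integral>y. g y \<partial>P J)\<bar> powr p) \<partial>P J) \<le> ennreal (?D powr p)"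
        unfolding C_def w_def by (rule insert.IH[OF gF])
      show "(\<integral>\<^sup>+x. ennreal (\<bar>\<integral>y. g y \<partial>P J\<bar> powr p) \<partial>P J) \<le> ennreal ((\<integral>y. g y \<partial>P J) powr p)"
        using Eg0 by (simp add: PJ.emeasure_space_1)
    qed (use Eg0 in auto)
    also have "\<dots> \<le> ennreal (Bg powr p)"
    proof (intro ennreal_leI powr_mono2)
      \<comment> \<open>The set \<open>{}\<close> has weight \<open>p powr 0 = 1\<close> and
        contributes \<open>C\<close> times the mean of \<open>g\<close>. As
        \<open>C \<ge> 1\<close>, this covers the mean that Minkowski's inequality adds with
        coefficient 1.\<close>
      have "Bg = C * (\<integral>y. g y \<partial>P J) + ?D"
        unfolding Bg_def using J(1) p
        by (subst sum.remove[of _ "{}"]) (auto simp: w_def sup_slots_empty distrib_left)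
      moreover have "(\<integral>y. g y \<partial>P J) \<le> C * (\<integral>y. g y \<partial>P J)" using C Eg0 by (simp add: mult_le_cancel_right1)
      ultimately show "?D + (\<integral>y. g y \<partial>P J) \<le> Bg" by simp
      show "0 \<le> ?D + (\<integral>y. g y \<partial>P J)" using C Eg0 by (intro add_nonneg_nonneg mult_nonneg_nonneg sum_nonneg w0 sg0) auto
    qed (use p in auto)
    finally show ?thesis using multi_seminorm_nonneg[OF gF] by simp
  qed
  \<comment> \<open>Tonelli puts slot \<open>i\<close> innermost. For fixed \<open>x\<close> the
    integrand there is the deviation of a seminorm of one vector from its mean \<open>m x\<close>,
    and the concentration hypothesis turns it into a multiple of \<open>g x powr p\<close>.\<close>
  have part1: "(\<integral>\<^sup>+x. ennreal (\<bar>F x - m x\<bar> powr p) \<partial>P (insert i J)) \<le> ennreal ((K * sqrt p * Bg) powr p)"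
  proof -
    have "(\<integral>\<^sup>+x. ennreal (\<bar>F x - m x\<bar> powr p) \<partial>P (insert i J))
        = (\<integral>\<^sup>+x. \<integral>\<^sup>+u. ennreal (\<bar>F (x(i := u)) - m x\<bar> powr p) \<partial>\<mu> \<partial>P J)"
      using J by (subst product_nn_integral_insert) (auto simp: m_upd)
    also have "\<dots> \<le> (\<integral>\<^sup>+x. ennreal ((K * sqrt p) powr p) * ennreal (g x powr p) \<partial>P J)"
    proof (rule nn_integral_mono)
      fix x
      have sem: "seminorm_on {1..n} (\<lambda>u. F (x(i := u)))" by (rule seminorm_on_slot[OF F]) simp
      have sup: "(SUP a\<in>unit_ball n. F (x(i := a))) \<le> g x"
        unfolding g_def by (rule SUP_slot_le_sup_slots[OF fin F])
      \<comment> \<open>Monotonicity of \<open>powr\<close> needs a nonnegative smaller base, and a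
        real \<open>SUP\<close> is known to be nonnegative only once its set is bounded
        above.\<close>
      have sup0: "0 \<le> (SUP a\<in>unit_ball n. F (x(i := a)))"
      proof -
        have "bdd_above ((\<lambda>a. F (x(i := a))) ` unit_ball n)"
        proof (rule bdd_aboveI2)
          fix a assume "a \<in> unit_ball n"
          moreover have eq: "x(i := a) = (\<lambda>k. if k \<in> {i} then (\<lambda>k\<in>{i}. a) k else x k)" by (auto simp: fun_eq_iff)
          ultimately show "F (x(i := a)) \<le> g x"
            unfolding g_def eq by (intro sup_slots_upper[OF fin F]) auto
        qed
        from cSUP_upper[OF zero_in_unit_ball this] show ?thesis
          using multi_seminorm_nonneg[OF F] by (rule order.trans[rotated])
      qed
      have "(\<integral>\<^sup>+u. ennreal (\<bar>F (x(i := u)) - m x\<bar> powr p) \<partial>\<mu>)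
          \<le> ennreal ((K * sqrt p * (SUP a\<in>unit_ball n. F (x(i := a)))) powr p)"
        unfolding m_def mean_slot_def by (rule seminorm_deviation[OF sem p])
      also have "\<dots> \<le> ennreal ((K * sqrt p * g x) powr p)"
        using p K_nonneg sup sup0 by (intro ennreal_leI powr_mono2 mult_left_mono) auto
      also have "\<dots> = ennreal ((K * sqrt p) powr p) * ennreal (g x powr p)"
        using p K_nonneg multi_seminorm_nonneg[OF gF] by (simp add: powr_mult ennreal_mult)
      finally show "(\<integral>\<^sup>+u. ennreal (\<bar>F (x(i := u)) - m x\<bar> powr p) \<partial>\<mu>)
          \<le> ennreal ((K * sqrt p) powr p) * ennreal (g x powr p)" .
    qed
    also have "\<dots> = ennreal ((K * sqrt p) powr p) * (\<integral>\<^sup>+x. ennreal (g x powr p) \<partial>P J)"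
      by (rule nn_integral_cmult) simp
    also have "\<dots> \<le> ennreal ((K * sqrt p) powr p) * ennreal (Bg powr p)"
      by (intro mult_left_mono g_moment) simp
    also have "\<dots> = ennreal ((K * sqrt p * Bg) powr p)"
      using p K_nonneg B0 by (simp add: powr_mult ennreal_mult)
    finally show ?thesis .
  qed
  \<comment> \<open>\<open>m\<close> ignores slot \<open>i\<close>, which therefore integrates to 1
    and leaves the induction hypothesis over \<open>J\<close>.\<close>
  have part2: "(\<integral>\<^sup>+x. ennreal (\<bar>m x - (\<integral>y. m y \<partial>P J)\<bar> powr p) \<partial>P (insert i J)) \<le> ennreal (B2 powr p)"
  proof -
    have "(\<integral>\<^sup>+x. ennreal (\<bar>m x - (\<integral>y. m y \<partial>P J)\<bar> powr p) \<partial>P (insert i J))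
        = (\<integral>\<^sup>+x. ennreal (\<bar>m x - (\<integral>y. m y \<partial>P J)\<bar> powr p) \<partial>P J)"
      using J by (subst product_nn_integral_insert) (auto simp: m_upd emeasure_space_1)
    also have "\<dots> \<le> ennreal (B2 powr p)"
      unfolding B2_def C_def w_def by (rule insert.IH[OF mF])
    finally show ?thesis .
  qed
  have "(\<integral>\<^sup>+x. ennreal (\<bar>F x - (\<integral>y. F y \<partial>P (insert i J))\<bar> powr p) \<partial>P (insert i J))
      = (\<integral>\<^sup>+x. ennreal (\<bar>(F x - m x) + (m x - (\<integral>y. m y \<partial>P J))\<bar> powr p) \<partial>P (insert i J))"
    by (simp add: EF)
  also have "\<dots> \<le> ennreal ((K * sqrt p * Bg + B2) powr p)"
    by (rule Minkowski_powr[OF _ _ p _ _ part1 part2]) (use K_nonneg p B0 in auto)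
  also have "\<dots> \<le> ennreal (((1 + K) ^ card (insert i J) * (\<Sum>I\<in>Pow (insert i J) - {{}}. w I * E I)) powr p)"
  proof (intro ennreal_leI powr_mono2)
    \<comment> \<open>The factor \<open>sqrt p\<close> paid for one conditional deviation is exactly
      the change of weight when \<open>i\<close> joins \<open>I\<close>.\<close>
    have w_insert: "sqrt p * w I = w (insert i I)" if "I \<in> Pow J" for I
    proof -
      have "card (insert i I) = Suc (card I)" using that J by (auto intro!: card_insert_disjoint dest: finite_subset)
      then have "w (insert i I) = p powr (1/2 + real (card I) / 2)" by (simp add: w_def add_divide_distrib)
      then show ?thesis using p by (simp add: powr_add powr_half_sqrt w_def)
    qed
    have inj: "inj_on (insert i) (Pow J)"
      using J(2) by (auto simp: inj_on_def)
    \<comment> \<open>\<open>B2\<close> will account for the first family and \<open>Bg\<close> for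
      the second. Only the first loses \<open>{}\<close>: the set \<open>{i}\<close> comes from
      \<open>{}\<close> and pairs with the mean of \<open>g\<close>.\<close>
    have split: "Pow (insert i J) - {{}} = (Pow J - {{}}) \<union> insert i ` Pow J"
      by (auto simp: Pow_insert)
    have S: "(\<Sum>I\<in>Pow (insert i J) - {{}}. w I * E I)
        = (\<Sum>I\<in>Pow J - {{}}. w I * E I) + (\<Sum>I\<in>Pow J. w (insert i I) * E (insert i I))"
      unfolding split using J by (subst sum.union_disjoint) (auto simp: sum.reindex[OF inj])
    have "K * sqrt p * Bg \<le> K * C * (\<Sum>I\<in>Pow J. w (insert i I) * E (insert i I))"
    proof -
      have "K * sqrt p * Bg = K * C * (\<Sum>I\<in>Pow J. w (insert i I) * (\<integral>x. sup_slots n I g x \<partial>P J))"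
        unfolding Bg_def by (simp add: sum_distrib_left w_insert[symmetric] mult_ac)
      also have "\<dots> \<le> K * C * (\<Sum>I\<in>Pow J. w (insert i I) * E (insert i I))"
        unfolding g_def E_def using K_nonneg C
        by (intro mult_left_mono sum_mono integral_sup_slots_sup_le[OF J F] w0) auto
      finally show ?thesis .
    qed
    also have "\<dots> \<le> (1 + K) * C * (\<Sum>I\<in>Pow J. w (insert i I) * E (insert i I))"
      using C K_nonneg by (intro mult_right_mono sum_nonneg mult_nonneg_nonneg w0 E0) auto
    finally have 1: "K * sqrt p * Bg \<le> (1 + K) * C * (\<Sum>I\<in>Pow J. w (insert i I) * E (insert i I))" .
    have "B2 \<le> C * (\<Sum>I\<in>Pow J - {{}}. w I * E I)"
      unfolding B2_def m_def E_def using C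
      by (intro mult_left_mono sum_mono integral_sup_slots_mean_le[OF J F] w0) auto
    also have "\<dots> \<le> (1 + K) * C * (\<Sum>I\<in>Pow J - {{}}. w I * E I)"
      using C K_nonneg by (intro mult_right_mono sum_nonneg mult_nonneg_nonneg w0 E0) (auto simp: algebra_simps)
    finally show "K * sqrt p * Bg + B2 \<le> (1 + K) ^ card (insert i J) * (\<Sum>I\<in>Pow (insert i J) - {{}}. w I * E I)"
      using 1 J unfolding S by (simp add: C_def distrib_left)
    show "0 \<le> K * sqrt p * Bg + B2" using K_nonneg p B0 by simp
  qed (use p in auto)
  finally show ?case unfolding w_def E_def .
qed

end

section \<open>Tensors and the tail bound\<close>

lemma seminorm_onD:
  assumes "seminorm_on J \<phi>"
  shows seminorm_on_nonneg: "x \<in> coord_space J \<Longrightarrow> 0 \<le> \<phi> x"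
    and seminorm_on_add: "x \<in> coord_space J \<Longrightarrow> y \<in> coord_space J \<Longrightarrow> \<phi> (\<lambda>j\<in>J. x j + y j) \<le> \<phi> x + \<phi> y"
    and seminorm_on_scale: "x \<in> coord_space J \<Longrightarrow> \<phi> (\<lambda>j\<in>J. c * x j) = \<bar>c\<bar> * \<phi> x"
  using assms unfolding seminorm_on_def by blast+

lemma restrict_in_coord_space: "restrict x J \<in> coord_space J"
  by (simp add: coord_space_def)

text \<open>The basis expansion again, now for extensional arrays, where every summand has to be
  restricted to \<open>J\<close>. The index set is arbitrary because the expansion is applied to
  vectors and to tensors.\<close>

lemma seminorm_on_expand:
  assumes \<phi>: "seminorm_on J \<phi>" and J: "finite J" and x: "x \<in> coord_space J"
  shows "\<phi> x \<le> (\<Sum>j\<in>J. \<bar>x j\<bar> * \<phi> (\<lambda>k\<in>J. if k = j then 1 else 0))"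
proof -
  let ?e = "\<lambda>j. \<lambda>k\<in>J. if k = j then 1 else 0 :: real"
  have "\<phi> (\<lambda>k\<in>J. if k \<in> S then x k else 0) \<le> (\<Sum>j\<in>S. \<bar>x j\<bar> * \<phi> (?e j))" if "finite S" for S
    using that
  proof (induction S)
    case empty
    have eq: "(\<lambda>k\<in>J. if k \<in> {} then x k else 0) = (\<lambda>k\<in>J. 0 * x k)" by auto
    show ?case unfolding eq seminorm_on_scale[OF \<phi> x] by simp
  next
    case (insert j S)
    have eq: "(\<lambda>k\<in>J. if k \<in> insert j S then x k else 0)
        = (\<lambda>k\<in>J. (\<lambda>k\<in>J. x j * ?e j k) k + (\<lambda>k\<in>J. if k \<in> S then x k else 0) k)"
      using insert.hyps by (auto simp: fun_eq_iff)
    have "\<phi> (\<lambda>k\<in>J. if k \<in> insert j S then x k else 0)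
        \<le> \<phi> (\<lambda>k\<in>J. x j * ?e j k) + \<phi> (\<lambda>k\<in>J. if k \<in> S then x k else 0)"
      unfolding eq by (intro seminorm_on_add[OF \<phi>] restrict_in_coord_space)
    also have "\<dots> \<le> \<bar>x j\<bar> * \<phi> (?e j) + (\<Sum>j\<in>S. \<bar>x j\<bar> * \<phi> (?e j))"
      by (intro add_mono insert.IH eq_refl seminorm_on_scale[OF \<phi>] restrict_in_coord_space)
    finally show ?case unfolding sum.insert[OF insert.hyps] .
  qed
  from this[OF J] have "\<phi> (\<lambda>k\<in>J. if k \<in> J then x k else 0) \<le> (\<Sum>j\<in>J. \<bar>x j\<bar> * \<phi> (?e j))" .
  moreover have "(\<lambda>k\<in>J. if k \<in> J then x k else 0) = x"
    using x by (auto simp: coord_space_def PiE_iff extensional_def fun_eq_iff)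
  ultimately show ?thesis by simp
qed

lemma seminorm_on_bdd_unit_ball:
  assumes \<phi>: "seminorm_on {1..n} \<phi>"
  shows "bdd_above (\<phi> ` unit_ball n)"
proof (rule bdd_aboveI2)
  let ?e = "\<lambda>j. \<lambda>k\<in>{1..n}. if k = j then 1 else 0 :: real"
  fix a assume a: "a \<in> unit_ball n"
  have "\<phi> a \<le> (\<Sum>j\<in>{1..n}. \<bar>a j\<bar> * \<phi> (?e j))"
    by (rule seminorm_on_expand[OF \<phi>]) (use a in \<open>auto simp: unit_ball_def\<close>)
  also have "\<dots> \<le> (\<Sum>j\<in>{1..n}. 1 * \<phi> (?e j))"
    by (intro sum_mono mult_right_mono unit_ball_coord_le[OF a] seminorm_on_nonneg[OF \<phi>] restrict_in_coord_space)
  finally show "\<phi> a \<le> (\<Sum>j\<in>{1..n}. 1 * \<phi> (?e j))" .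
qed

lemma basis_vector_in_unit_sphere:
  assumes "k \<in> {1..n}"
  shows "(\<lambda>j\<in>{1..n}. if j = k then 1 else 0) \<in> unit_sphere n"
proof -
  have "L2_set (\<lambda>j\<in>{1..n}. if j = k then 1 else 0 :: real) {1..n} = sqrt (\<Sum>j\<in>{1..n}. if j = k then 1 else 0)"
    unfolding L2_set_def by (intro arg_cong[where f = sqrt] sum.cong) auto
  also have "\<dots> = 1" using assms by simp
  finally show ?thesis by (simp add: unit_sphere_def restrict_in_coord_space)
qed

lemma unit_sphere_subset_unit_ball: "unit_sphere n \<subseteq> unit_ball n"
  by (auto simp: unit_sphere_def unit_ball_def)

text \<open>Views a seminorm of one vector as a function of the single slot \<open>i\<close>, so
  that measurability of seminorms is a case of \<open>multi_seminorm_measurable\<close>.\<close>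

lemma multi_seminorm_seminorm_on:
  assumes \<phi>: "seminorm_on {1..n} \<phi>"
  shows "multi_seminorm {i} n (\<lambda>x. \<phi> (restrict (x i) {1..n}))"
  unfolding multi_seminorm_def
proof (intro conjI allI ballI impI)
  fix x y :: "nat \<Rightarrow> nat \<Rightarrow> real" and u v :: "nat \<Rightarrow> real" and c :: real and k
  show "0 \<le> \<phi> (restrict (x i) {1..n})" by (intro seminorm_on_nonneg[OF \<phi>] restrict_in_coord_space)
  show "\<phi> (restrict (x i) {1..n}) = \<phi> (restrict (y i) {1..n})" if "\<forall>i\<in>{i}. \<forall>j\<in>{1..n}. x i j = y i j"
    using that by (intro arg_cong[where f = \<phi>] restrict_ext) auto
  assume "k \<in> {i}"
  then have k: "k = i" by simp
  have "restrict (\<lambda>j. u j + v j) {1..n} = (\<lambda>j\<in>{1..n}. restrict u {1..n} j + restrict v {1..n} j)"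
    by (intro restrict_ext) simp
  then show "\<phi> (restrict ((x(k := \<lambda>j. u j + v j)) i) {1..n})
      \<le> \<phi> (restrict ((x(k := u)) i) {1..n}) + \<phi> (restrict ((x(k := v)) i) {1..n})"
    unfolding k fun_upd_same
    using seminorm_on_add[OF \<phi> restrict_in_coord_space restrict_in_coord_space] by metis
  have "restrict (\<lambda>j. c * u j) {1..n} = (\<lambda>j\<in>{1..n}. c * restrict u {1..n} j)"
    by (intro restrict_ext) simp
  then show "\<phi> (restrict ((x(k := \<lambda>j. c * u j)) i) {1..n}) \<le> \<bar>c\<bar> * \<phi> (restrict ((x(k := u)) i) {1..n})"
    unfolding k fun_upd_same
    using seminorm_on_scale[OF \<phi> restrict_in_coord_space] by (metis order_refl)
qed

lemma seminorm_on_measurable: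
  fixes n :: nat
  assumes \<phi>: "seminorm_on {1..n} \<phi>"
  shows "\<phi> \<in> borel_measurable (PiM {1..n} (\<lambda>_. borel))"
proof -
  have "(\<lambda>u. \<phi> (restrict u {1..n})) \<in> borel_measurable (PiM {1..n} (\<lambda>_. borel))"
    by (rule multi_seminorm_measurable[OF _ multi_seminorm_seminorm_on[OF \<phi>, of 0], where f = "\<lambda>u _. u"])
       (auto intro: measurable_component_singleton)
  moreover have "restrict u {1..n} = u" if "u \<in> space (PiM {1..n} (\<lambda>_. borel :: real measure))" for u
    using that by (simp add: space_PiM extensional_restrict PiE_iff)
  ultimately show ?thesis by (subst (asm) measurable_cong[where g = \<phi>]) auto
qed

section \<open>Rank-one tensors as functions of their slots\<close>

lemma tensor_in_coord_space: "tensor d n x \<in> coord_space (multi_indices d n)"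
  unfolding tensor_def by (rule restrict_in_coord_space)

text \<open>By \<open>upd\<close>, each coordinate of the tensor is linear in the vector of slot
  \<open>i\<close>. Sums and multiples in that slot are thus sums and multiples of arrays, where the
  laws of \<open>\<psi>\<close> apply.\<close>

lemma multi_seminorm_tensor:
  assumes \<psi>: "seminorm_on (multi_indices d n) \<psi>"
  shows "multi_seminorm {1..d} n (\<lambda>x. \<psi> (tensor d n x))"
  unfolding multi_seminorm_def
proof (intro conjI allI ballI impI)
  fix x y :: "nat \<Rightarrow> nat \<Rightarrow> real" and u v :: "nat \<Rightarrow> real" and c :: real and i
  show "0 \<le> \<psi> (tensor d n x)" by (intro seminorm_on_nonneg[OF \<psi>] tensor_in_coord_space)
  show "\<psi> (tensor d n x) = \<psi> (tensor d n y)" if "\<forall>i\<in>{1..d}. \<forall>j\<in>{1..n}. x i j = y i j"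
    unfolding tensor_def
    by (intro arg_cong[where f = \<psi>] restrict_ext prod.cong refl) (use that in \<open>auto simp: multi_indices_def PiE_iff\<close>)
  assume i: "i \<in> {1..d}"
  have upd: "tensor d n (x(i := w)) = (\<lambda>j\<in>multi_indices d n. w (j i) * (\<Prod>k\<in>{1..d} - {i}. x k (j k)))" for w
    unfolding tensor_def
  proof (rule restrict_ext)
    fix j
    have "(\<Prod>k = 1..d. (x(i := w)) k (j k)) = (x(i := w)) i (j i) * (\<Prod>k\<in>{1..d} - {i}. (x(i := w)) k (j k))"
      using i by (intro prod.remove) auto
    also have "(\<Prod>k\<in>{1..d} - {i}. (x(i := w)) k (j k)) = (\<Prod>k\<in>{1..d} - {i}. x k (j k))"
      by (intro prod.cong) auto
    finally show "(\<Prod>k = 1..d. (x(i := w)) k (j k)) = w (j i) * (\<Prod>k\<in>{1..d} - {i}. x k (j k))" by simp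
  qed
  have "tensor d n (x(i := \<lambda>j. u j + v j))
      = (\<lambda>j\<in>multi_indices d n. tensor d n (x(i := u)) j + tensor d n (x(i := v)) j)"
    unfolding upd by (intro restrict_ext) (simp add: distrib_right)
  then show "\<psi> (tensor d n (x(i := \<lambda>j. u j + v j))) \<le> \<psi> (tensor d n (x(i := u))) + \<psi> (tensor d n (x(i := v)))"
    using seminorm_on_add[OF \<psi> tensor_in_coord_space tensor_in_coord_space] by metis
  have "tensor d n (x(i := \<lambda>j. c * u j)) = (\<lambda>j\<in>multi_indices d n. c * tensor d n (x(i := u)) j)"
    unfolding upd by (intro restrict_ext) simp
  then show "\<psi> (tensor d n (x(i := \<lambda>j. c * u j))) \<le> \<bar>c\<bar> * \<psi> (tensor d n (x(i := u)))"
    using seminorm_on_scale[OF \<psi> tensor_in_coord_space] by (metis order_refl)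
qed

text \<open>Rank-one tensors span, so a nonzero seminorm does not vanish on all of them.\<close>

lemma seminorm_on_rank_one_pos:
  assumes \<psi>: "seminorm_on (multi_indices d n) \<psi>"
    and T: "T \<in> coord_space (multi_indices d n)" "\<psi> T \<noteq> 0"
  shows "\<exists>\<alpha> \<in> {1..d} \<rightarrow>\<^sub>E unit_ball n. 0 < \<psi> (tensor d n \<alpha>)"
proof -
  let ?J = "multi_indices d n"
  have J: "finite ?J" unfolding multi_indices_def by (intro finite_PiE) auto
  have "\<exists>j\<in>?J. 0 < \<psi> (\<lambda>k\<in>?J. if k = j then 1 else 0)"
  proof (rule ccontr)
    assume "\<not> ?thesis"
    then have "(\<Sum>j\<in>?J. \<bar>T j\<bar> * \<psi> (\<lambda>k\<in>?J. if k = j then 1 else 0)) \<le> 0"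
      by (intro sum_nonpos mult_nonneg_nonpos) (auto simp: not_less)
    then show False
      using seminorm_on_expand[OF \<psi> J T(1)] seminorm_on_nonneg[OF \<psi> T(1)] T(2) by linarith
  qed
  then obtain j where j: "j \<in> ?J" "0 < \<psi> (\<lambda>k\<in>?J. if k = j then 1 else 0)" by blast
  \<comment> \<open>The coordinate array at multi-index \<open>j\<close> is itself of rank one: the
    tensor product of the basis vectors numbered \<open>j 1\<close> to \<open>j d\<close>.\<close>
  define \<alpha> where "\<alpha> = (\<lambda>i\<in>{1..d}. \<lambda>k\<in>{1..n}. if k = j i then 1 else 0 :: real)"
  have "\<alpha> i \<in> unit_ball n" if "i \<in> {1..d}" for i
    using that j(1) unit_sphere_subset_unit_ball basis_vector_in_unit_sphere[of "j i" n]
    by (auto simp: \<alpha>_def multi_indices_def PiE_iff)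
  then have "\<alpha> \<in> {1..d} \<rightarrow>\<^sub>E unit_ball n" by (auto simp: \<alpha>_def)
  moreover have "tensor d n \<alpha> = (\<lambda>k\<in>?J. if k = j then 1 else 0)"
    unfolding tensor_def
  proof (rule restrict_ext)
    fix k assume k: "k \<in> ?J"
    have "(\<Prod>i = 1..d. \<alpha> i (k i)) = (\<Prod>i = 1..d. if k i = j i then 1 else 0)"
      using k by (intro prod.cong) (auto simp: \<alpha>_def multi_indices_def PiE_iff)
    also have "\<dots> = (if k = j then 1 else 0)"
    proof (cases "k = j")
      case False
      then obtain i where "i \<in> {1..d}" "k i \<noteq> j i"
        using k j(1) unfolding multi_indices_def by (meson PiE_ext)
      then show ?thesis using False by (auto intro!: prod_zero)
    qed simp
    finally show "(\<Prod>i = 1..d. \<alpha> i (k i)) = (if k = j then 1 else 0)" .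
  qed
  ultimately show ?thesis using j(2) by metis
qed

section \<open>From moments to tails, and transfer to the independent copies\<close>

lemma Lp_norm_le_imp_nn_integral_le:
  assumes L: "Lp_norm M p \<xi> \<le> ennreal B" and B: "B \<ge> 0" and p: "p > 0"
  shows "(\<integral>\<^sup>+\<omega>. ennreal (\<bar>\<xi> \<omega>\<bar> powr p) \<partial>M) \<le> ennreal (B powr p)"
proof -
  define m where "m = (\<integral>\<^sup>+\<omega>. ennreal (\<bar>\<xi> \<omega>\<bar> powr p) \<partial>M)"
  \<comment> \<open>A finite bound on \<open>Lp_norm\<close> excludes its \<open>\<infinity>\<close>
    branch. Without this, \<open>enn2real\<close> could have sent an infinite moment to 0.\<close>
  have fin: "m \<noteq> \<infinity>"
    using L unfolding Lp_norm_def m_def[symmetric] by (auto simp: Let_def top_unique)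
  then have "enn2real m powr (1 / p) \<le> B"
    using L B unfolding Lp_norm_def m_def[symmetric] by (simp add: Let_def)
  then have "(enn2real m powr (1 / p)) powr p \<le> B powr p"
    using p by (intro powr_mono2) auto
  then have "enn2real m \<le> B powr p" using p by (simp add: powr_powr)
  then have "ennreal (enn2real m) \<le> ennreal (B powr p)" by (rule ennreal_leI)
  moreover have "ennreal (enn2real m) = m" using fin by (intro ennreal_enn2real) (simp add: less_top)
  ultimately show ?thesis unfolding m_def by simp
qed

text \<open>Markov's inequality for the t-th power at threshold \<open>exp 1 * D\<close> leaves the
  ratio of \<open>D powr t\<close> to \<open>(exp 1 * D) powr t\<close>, which is
  \<open>exp (- t)\<close>. For \<open>D = 0\<close> the event would be the whole space.\<close>

lemma tail_from_moment:
  fixes Z :: "'a \<Rightarrow> real"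
  assumes [measurable]: "Z \<in> borel_measurable M" and D: "D > 0" and t: "t > 0"
    and Z: "(\<integral>\<^sup>+\<omega>. ennreal (\<bar>Z \<omega>\<bar> powr t) \<partial>M) \<le> ennreal (D powr t)"
  shows "measure M {\<omega> \<in> space M. \<bar>Z \<omega>\<bar> \<ge> exp 1 * D} \<le> exp (- t)"
proof -
  let ?c = "1 / (exp 1 * D) powr t"
  have "emeasure M {\<omega> \<in> space M. \<bar>Z \<omega>\<bar> \<ge> exp 1 * D}
      \<le> emeasure M {\<omega> \<in> space M. 1 \<le> ennreal ?c * ennreal (\<bar>Z \<omega>\<bar> powr t)}"
  proof (intro emeasure_mono subsetI)
    fix \<omega> assume \<omega>: "\<omega> \<in> {\<omega> \<in> space M. \<bar>Z \<omega>\<bar> \<ge> exp 1 * D}"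
    then have "(exp 1 * D) powr t \<le> \<bar>Z \<omega>\<bar> powr t" using D t by (intro powr_mono2) auto
    then have "1 \<le> ?c * \<bar>Z \<omega>\<bar> powr t" using D by (simp add: field_simps)
    then show "\<omega> \<in> {\<omega> \<in> space M. 1 \<le> ennreal ?c * ennreal (\<bar>Z \<omega>\<bar> powr t)}"
      using \<omega> by (simp add: ennreal_mult'[symmetric])
  qed simp
  also have "\<dots> \<le> ennreal ?c * (\<integral>\<^sup>+\<omega>. ennreal (\<bar>Z \<omega>\<bar> powr t) * indicator (space M) \<omega> \<partial>M)"
    by (rule nn_integral_Markov_inequality) auto
  also have "\<dots> = ennreal ?c * (\<integral>\<^sup>+\<omega>. ennreal (\<bar>Z \<omega>\<bar> powr t) \<partial>M)"
    by (intro arg_cong2[where f = "(*)"] refl nn_integral_cong) simp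
  also have "\<dots> \<le> ennreal ?c * ennreal (D powr t)" by (intro mult_left_mono Z) simp
  also have "\<dots> = ennreal (exp (- t))"
  proof -
    have "(exp 1 * D) powr t = exp t * D powr t" by (subst powr_mult) (simp add: powr_def)
    then show ?thesis using D by (simp add: ennreal_mult'[symmetric] exp_minus field_simps)
  qed
  finally show ?thesis unfolding measure_def by (rule enn2real_leI[rotated]) simp
qed

text \<open>Passes from \<open>X\<close> to its law and from the sphere to the ball. Since
  \<open>n \<ge> 1\<close>, the sphere contains a basis vector, so the \<open>SUP\<close> over it is
  that of a nonempty bounded set: it is nonnegative and at most the one over the ball.\<close>

lemma concentrated_distr:
  assumes M: "prob_space M" and X: "X \<in> measurable M (PiM {1..n} (\<lambda>_. borel))"
    and n: "n \<ge> 1" and K: "K > 0"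
    and H: "\<forall>\<phi>. seminorm_on {1..n} \<phi> \<longrightarrow>
       integrable M (\<lambda>\<omega>. \<phi> (X \<omega>)) \<and>
       (\<forall>p \<ge> 1. Lp_norm M p (\<lambda>\<omega>. \<phi> (X \<omega>) - (\<integral>\<omega>'. \<phi> (X \<omega>') \<partial>M))
                  \<le> ennreal (K * sqrt p * (SUP \<alpha> \<in> unit_sphere n. \<phi> \<alpha>)))"
  shows "concentrated (distr M (PiM {1..n} (\<lambda>_. borel)) X) n K"
proof -
  interpret prob_space M by (rule M)
  interpret D: prob_space "distr M (PiM {1..n} (\<lambda>_. borel)) X" by (rule prob_space_distr[OF X])
  show ?thesis
  proof
    show "sets (distr M (PiM {1..n} (\<lambda>_. borel)) X) = sets (PiM {1..n} (\<lambda>_. borel))" by simp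
    show "0 \<le> K" using K by simp
    fix \<phi> assume \<phi>: "seminorm_on {1..n} \<phi>"
    note [measurable] = seminorm_on_measurable[OF \<phi>]
    show "integrable (distr M (PiM {1..n} (\<lambda>_. borel)) X) \<phi>"
      unfolding integrable_distr_eq[OF X seminorm_on_measurable[OF \<phi>]] using H \<phi> by blast
    fix p :: real assume p: "1 \<le> p"
    have ne: "unit_sphere n \<noteq> {}" using basis_vector_in_unit_sphere[of 1 n] n by auto
    have "0 \<le> (SUP a\<in>unit_sphere n. \<phi> a)"
    proof -
      obtain a where a: "a \<in> unit_sphere n" using ne by blast
      then have "0 \<le> \<phi> a" by (intro seminorm_on_nonneg[OF \<phi>]) (simp add: unit_sphere_def)
      also have "\<dots> \<le> (SUP a\<in>unit_sphere n. \<phi> a)"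
        by (intro cSUP_upper a bdd_above_mono[OF seminorm_on_bdd_unit_ball[OF \<phi>]] image_mono unit_sphere_subset_unit_ball)
      finally show ?thesis .
    qed
    moreover have "(SUP a\<in>unit_sphere n. \<phi> a) \<le> (SUP a\<in>unit_ball n. \<phi> a)"
      by (intro cSUP_subset_mono ne seminorm_on_bdd_unit_ball[OF \<phi>] unit_sphere_subset_unit_ball) auto
    ultimately have le: "0 \<le> K * sqrt p * (SUP a\<in>unit_sphere n. \<phi> a)"
        "K * sqrt p * (SUP a\<in>unit_sphere n. \<phi> a) \<le> K * sqrt p * (SUP a\<in>unit_ball n. \<phi> a)"
      using K p by (auto intro!: mult_left_mono)
    have "(\<integral>\<^sup>+\<omega>. ennreal (\<bar>\<phi> (X \<omega>) - (\<integral>\<omega>'. \<phi> (X \<omega>') \<partial>M)\<bar> powr p) \<partial>M)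
        \<le> ennreal ((K * sqrt p * (SUP a\<in>unit_sphere n. \<phi> a)) powr p)"
      using H \<phi> p le by (intro Lp_norm_le_imp_nn_integral_le) auto
    also have "\<dots> \<le> ennreal ((K * sqrt p * (SUP a\<in>unit_ball n. \<phi> a)) powr p)"
      using p le by (intro ennreal_leI powr_mono2) auto
    finally show "(\<integral>\<^sup>+u. ennreal (\<bar>\<phi> u - (\<integral>v. \<phi> v \<partial>distr M (PiM {1..n} (\<lambda>_. borel)) X)\<bar> powr p)
          \<partial>distr M (PiM {1..n} (\<lambda>_. borel)) X)
        \<le> ennreal ((K * sqrt p * (SUP a\<in>unit_ball n. \<phi> a)) powr p)"
      unfolding integral_distr[OF X seminorm_on_measurable[OF \<phi>]]
      by (subst nn_integral_distr[OF X]) measurable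
  qed
qed

text \<open>Independence and equality of the laws identify the joint law of the copies with the
  product measure of \<open>moment_bound\<close>. The point \<open>\<alpha>\<close> with
  \<open>0 < F \<alpha>\<close> serves to make the threshold strictly positive.\<close>

lemma (in concentrated) independent_copies_tail:
  assumes M: "prob_space M"
    and ind: "prob_space.indep_vars M (\<lambda>_. PiM {1..n} (\<lambda>_. borel)) Xs J"
    and law: "\<And>i. i \<in> J \<Longrightarrow> distr M (PiM {1..n} (\<lambda>_. borel)) (Xs i) = \<mu>"
    and J: "finite J" "J \<noteq> {}" and F: "multi_seminorm J n F" and t: "t \<ge> 1"
    and pos: "\<alpha> \<in> J \<rightarrow>\<^sub>E unit_ball n" "0 < F \<alpha>"
  shows "measure M {\<omega> \<in> space M.
      \<bar>F (\<lambda>i. Xs i \<omega>) - (\<integral>\<omega>'. F (\<lambda>i. Xs i \<omega>') \<partial>M)\<bar>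
        \<ge> exp 1 * (1 + K) ^ card J *
          (\<Sum>I\<in>Pow J - {{}}. t powr (real (card I) / 2) * (\<integral>\<omega>'. sup_slots n I F (\<lambda>i. Xs i \<omega>') \<partial>M))}
    \<le> exp (- t)"
proof -
  interpret Q: prob_space M by (rule M)
  let ?N = "PiM {1..n} (\<lambda>_. borel :: real measure)"
  \<comment> \<open>The extensional version of the tuple of copies, as the product space demands;
    functions of slots in \<open>J\<close> cannot tell the two apart.\<close>
  define Y where "Y = (\<lambda>\<omega>. \<lambda>i\<in>J. Xs i \<omega>)"
  have Xs: "Xs i \<in> measurable M ?N" if "i \<in> J" for i
    using ind that unfolding Q.indep_vars_def by auto
  have Y: "Y \<in> measurable M (PiM J (\<lambda>_. ?N))"
    unfolding Y_def using Xs by (intro measurable_restrict) auto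
  have "distr M (PiM J (\<lambda>_. ?N)) Y = PiM J (\<lambda>i. distr M ?N (Xs i))"
    using iffD1[OF Q.indep_vars_iff_distr_eq_PiM'[OF J(2)] ind] Xs unfolding Y_def by blast
  also have "\<dots> = P J" using law by (intro PiM_cong) auto
  finally have P: "P J = distr M (PiM J (\<lambda>_. ?N)) Y" by simp
  have meas: "G \<in> borel_measurable (PiM J (\<lambda>_. ?N))" if "multi_seminorm J\<^sub>0 n G" "J\<^sub>0 \<subseteq> J" for G J\<^sub>0
    using measurable_P[OF J(1) that(2,1)] unfolding P by simp
  have GY: "G (Y \<omega>) = G (\<lambda>i. Xs i \<omega>)" if "multi_seminorm J\<^sub>0 n G" "J\<^sub>0 \<subseteq> J" for G J\<^sub>0 \<omega>
    by (rule multi_seminorm_cong[OF that(1)]) (use that(2) in \<open>auto simp: Y_def\<close>)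
  have int: "(\<integral>x. G x \<partial>P J) = (\<integral>\<omega>. G (\<lambda>i. Xs i \<omega>) \<partial>M)" if "multi_seminorm J\<^sub>0 n G" "J\<^sub>0 \<subseteq> J" for G J\<^sub>0
    unfolding P by (subst integral_distr[OF Y meas[OF that]]) (simp add: GY[OF that])
  note sF = multi_seminorm_sup_slots[OF J(1) F]
  define S where "S = (\<Sum>I\<in>Pow J - {{}}. t powr (real (card I) / 2) * (\<integral>x. sup_slots n I F x \<partial>P J))"
  have S: "S = (\<Sum>I\<in>Pow J - {{}}. t powr (real (card I) / 2) * (\<integral>\<omega>'. sup_slots n I F (\<lambda>i. Xs i \<omega>') \<partial>M))"
    unfolding S_def by (intro sum.cong refl arg_cong2[where f = "(*)"] int[OF sF]) auto
  \<comment> \<open>The term \<open>I = J\<close> alone is positive: with every slot replaced, the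
    supremum no longer depends on \<open>x\<close> and is at least
    \<open>F \<alpha>\<close>.\<close>
  have S0: "S > 0"
  proof -
    interpret PJ: prob_space "P J" by (rule prob_space_P)
    have sup_pos: "0 < sup_slots n J F x" for x
    proof -
      have "F (\<lambda>i. if i \<in> J then \<alpha> i else x i) = F \<alpha>" by (rule multi_seminorm_cong[OF F]) simp
      then show ?thesis using sup_slots_upper[OF J(1) F pos(1), of x] pos(2) by simp
    qed
    have const: "sup_slots n J F x = sup_slots n J F \<alpha>" for x
      by (rule multi_seminorm_cong[OF sF[of J]]) auto
    have "(\<integral>x. sup_slots n J F x \<partial>P J) = (\<integral>x. sup_slots n J F \<alpha> \<partial>P J)"
      by (intro Bochner_Integration.integral_cong refl const)
    also have "\<dots> > 0" using sup_pos by (simp add: PJ.prob_space)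
    finally have "0 < t powr (real (card J) / 2) * (\<integral>x. sup_slots n J F x \<partial>P J)" using t by simp
    also have "\<dots> \<le> S"
      unfolding S_def using J
      by (intro member_le_sum mult_nonneg_nonneg integral_sup_slots_nonneg[OF J(1) F]) auto
    finally show ?thesis .
  qed
  define Z where "Z = (\<lambda>\<omega>. F (\<lambda>i. Xs i \<omega>) - (\<integral>\<omega>'. F (\<lambda>i. Xs i \<omega>') \<partial>M))"
  have FY: "(\<lambda>\<omega>. F (\<lambda>i. Xs i \<omega>)) = (\<lambda>\<omega>. F (Y \<omega>))" using GY[OF F] by auto
  note [measurable] = meas[OF F subset_refl]
  have "(\<lambda>\<omega>. F (\<lambda>i. Xs i \<omega>)) \<in> borel_measurable M"
    unfolding FY by (rule measurable_compose[OF Y meas[OF F subset_refl]])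
  then have Zm: "Z \<in> borel_measurable M" unfolding Z_def by simp
  have "(\<integral>\<^sup>+\<omega>. ennreal (\<bar>Z \<omega>\<bar> powr t) \<partial>M)
      = (\<integral>\<^sup>+x. ennreal (\<bar>F x - (\<integral>y. F y \<partial>P J)\<bar> powr t) \<partial>P J)"
  proof -
    have "(\<lambda>x. ennreal (\<bar>F x - (\<integral>\<omega>. F (\<lambda>i. Xs i \<omega>) \<partial>M)\<bar> powr t))
        \<in> borel_measurable (distr M (PiM J (\<lambda>_. ?N)) Y)"
      unfolding measurable_distr_eq1 by measurable
    from nn_integral_distr[OF Y this] show ?thesis
      unfolding int[OF F subset_refl] unfolding P by (simp add: Z_def GY[OF F subset_refl])
  qed
  also have "\<dots> \<le> ennreal (((1 + K) ^ card J * S) powr t)"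
    unfolding S_def by (rule moment_bound[OF t J(1) F])
  finally have "measure M {\<omega> \<in> space M. \<bar>Z \<omega>\<bar> \<ge> exp 1 * ((1 + K) ^ card J * S)} \<le> exp (- t)"
    using S0 K_nonneg t by (intro tail_from_moment Zm) auto
  then show ?thesis unfolding S Z_def by (simp add: mult.assoc)
qed

text \<open>The zero seminorm is excluded: its deviation and its threshold are both 0, so the event
  defined by \<open>\<ge>\<close> has probability 1, which exceeds \<open>exp (- t)\<close>.\<close>

theorem corollary1:
  fixes K :: real and d :: nat
  assumes "K > 0" and "d \<ge> 1"
  shows "\<exists>K\<^sub>d :: real. \<forall>n \<ge> 1. \<forall>(M :: 'a measure) X Xs \<psi>.
    prob_space M \<longrightarrow>
    X \<in> measurable M (PiM {1..n} (\<lambda>_. borel)) \<longrightarrow>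
    (\<forall>\<phi>. seminorm_on {1..n} \<phi> \<longrightarrow>
       integrable M (\<lambda>\<omega>. \<phi> (X \<omega>)) \<and>
       (\<forall>p \<ge> 1. Lp_norm M p (\<lambda>\<omega>. \<phi> (X \<omega>) - (\<integral>\<omega>'. \<phi> (X \<omega>') \<partial>M))
                  \<le> ennreal (K * sqrt p * (SUP \<alpha> \<in> unit_sphere n. \<phi> \<alpha>)))) \<longrightarrow>
    prob_space.indep_vars M (\<lambda>_. PiM {1..n} (\<lambda>_. borel)) Xs {1..d} \<longrightarrow>
    (\<forall>i \<in> {1..d}. distr M (PiM {1..n} (\<lambda>_. borel)) (Xs i) = distr M (PiM {1..n} (\<lambda>_. borel)) X) \<longrightarrow>
    seminorm_on (multi_indices d n) \<psi> \<longrightarrow>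
    (\<exists>T \<in> coord_space (multi_indices d n). \<psi> T \<noteq> 0) \<longrightarrow>
    (\<forall>t \<ge> 1. measure M {\<omega> \<in> space M.
         \<bar>\<psi> (tensor d n (\<lambda>i. Xs i \<omega>)) - (\<integral>\<omega>'. \<psi> (tensor d n (\<lambda>i. Xs i \<omega>')) \<partial>M)\<bar>
         \<ge> K\<^sub>d * (\<Sum>I \<in> {I. I \<subseteq> {1..d} \<and> I \<noteq> {}}.
              t powr (real (card I) / 2) *
              (\<integral>\<omega>'. (SUP \<alpha> \<in> I \<rightarrow>\<^sub>E unit_ball n.
                       \<psi> (tensor d n (\<lambda>i. if i \<in> I then \<alpha> i else Xs i \<omega>'))) \<partial>M))}
       \<le> exp (- t))"
proof (intro exI[of _ "exp 1 * (1 + K) ^ d"] allI impI)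
  fix n :: nat and M and X :: "'a \<Rightarrow> nat \<Rightarrow> real" and Xs :: "nat \<Rightarrow> 'a \<Rightarrow> nat \<Rightarrow> real" and \<psi> and t :: real
  let ?N = "PiM {1..n} (\<lambda>_. borel :: real measure)"
  assume n: "1 \<le> n" and M: "prob_space (M :: 'a measure)" and X: "X \<in> measurable M ?N"
    and H: "\<forall>\<phi>. seminorm_on {1..n} \<phi> \<longrightarrow>
       integrable M (\<lambda>\<omega>. \<phi> (X \<omega>)) \<and>
       (\<forall>p \<ge> 1. Lp_norm M p (\<lambda>\<omega>. \<phi> (X \<omega>) - (\<integral>\<omega>'. \<phi> (X \<omega>') \<partial>M))
                  \<le> ennreal (K * sqrt p * (SUP \<alpha> \<in> unit_sphere n. \<phi> \<alpha>)))"
    and ind: "prob_space.indep_vars M (\<lambda>_. ?N) Xs {1..d}"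
    and law: "\<forall>i \<in> {1..d}. distr M ?N (Xs i) = distr M ?N X"
    and \<psi>: "seminorm_on (multi_indices d n) \<psi>" "\<exists>T \<in> coord_space (multi_indices d n). \<psi> T \<noteq> 0"
    and t: "1 \<le> t"
  interpret concentrated "distr M ?N X" n K
    by (rule concentrated_distr[OF M X n \<open>K > 0\<close> H])
  obtain \<alpha> where \<alpha>: "\<alpha> \<in> {1..d} \<rightarrow>\<^sub>E unit_ball n" "0 < \<psi> (tensor d n \<alpha>)"
    using seminorm_on_rank_one_pos[OF \<psi>(1)] \<psi>(2) by blast
  have I: "{I. I \<subseteq> {1..d} \<and> I \<noteq> {}} = Pow {1..d} - {{}}" by auto
  show "measure M {\<omega> \<in> space M.
         \<bar>\<psi> (tensor d n (\<lambda>i. Xs i \<omega>)) - (\<integral>\<omega>'. \<psi> (tensor d n (\<lambda>i. Xs i \<omega>')) \<partial>M)\<bar>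
         \<ge> exp 1 * (1 + K) ^ d * (\<Sum>I \<in> {I. I \<subseteq> {1..d} \<and> I \<noteq> {}}.
              t powr (real (card I) / 2) *
              (\<integral>\<omega>'. (SUP \<alpha> \<in> I \<rightarrow>\<^sub>E unit_ball n.
                       \<psi> (tensor d n (\<lambda>i. if i \<in> I then \<alpha> i else Xs i \<omega>'))) \<partial>M))}
       \<le> exp (- t)"
    using independent_copies_tail[OF M ind _ _ _ multi_seminorm_tensor[OF \<psi>(1)] t \<alpha>] law \<open>d \<ge> 1\<close>
    unfolding I by (simp add: sup_slots_def)
qed

end
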